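(* Let $f:\mathbb{N}\to\mathbb{C}$ be an additive function and $\alpha:\mathbb{N}\to\mathbb{R}_{\ge0}$ a multiplicative function with partial sums $S_\alpha(x)=\sum_{n\le x}\alpha(n)$. Suppose there exist $c_\alpha,\delta>0$, $\sigma\ge0$ and $\kappa\in\mathbb{R}$ such that \[ \sum_{\substack{n\le x\\ (n,a)=1}}\alpha(n)=c_\alpha x^\sigma(\log 3x)^{\kappa-1}\Big(F_\alpha(a)^{-1}+O\Big(\frac{1}{\log\log 3x}\Big)\Big) \] uniformly for all $x\ge1$ and all squarefree $a\in\mathbb{N}\cap[1,x^\delta]$ with at most two prime factors, where $F_\alpha(a)=\prod_{p\mid a}\sum_{k\ge0}\alpha(p^k)p^{-k\sigma}<\infty$. Suppose further that $\sum_{p^k\le x}\frac{\alpha(p^k)}{p^{k\sigma}}\log p^k\ll\log x$ for all $x\ge2$. Then for all $x\ge1$, \[ S_\alpha(x)^{-1}\sum_{n\le x}\alpha(n)\,|f(n)-A_{\alpha,f}(x)|^2\ll B_{\alpha,f}(x), \] where \[ A_{\alpha,f}(x)=\sum_{p^k\le x}\alpha(p^k)F_\alpha(p)^{-1}\frac{f(p^k)}{p^{k\sigma}},\qquad B_{\alpha,f}(x)=\sum_{p^k\le x}\alpha(p^k)\frac{|f(p^k)|^2}{p^{k\sigma}}\Big(1-\frac{\log p^k}{\log 3x}\Big)^{\min(\kappa-1,0)}. \] The implied constant depends at most on $\delta,\kappa$ and the implied constants in the two hypotheses.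
   Context: Sums over $p^k$ run over prime powers with $k\ge1$. An additive function satisfies $f(mn)=f(m)+f(n)$ for coprime $m,n$. *)

theory Defs
  imports Complex_Main "HOL-Computational_Algebra.Primes" "HOL-Computational_Algebra.Squarefree"
begin

(* Arithmetic functions live on the positive integers; values at 0 are never constrained or used. *)

definition additive_function :: "(nat \<Rightarrow> complex) \<Rightarrow> bool" where
  "additive_function f \<longleftrightarrow>
     (\<forall>m>0. \<forall>n>0. coprime m n \<longrightarrow> f (m * n) = f m + f n)"

definition multiplicative_function :: "(nat \<Rightarrow> real) \<Rightarrow> bool" where
  "multiplicative_function \<alpha> \<longleftrightarrow>
     \<alpha> 1 = 1 \<and> (\<forall>m>0. \<forall>n>0. coprime m n \<longrightarrow> \<alpha> (m * n) = \<alpha> m * \<alpha> n)"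

definition nats_upto :: "real \<Rightarrow> nat set" where
  "nats_upto x = {n. 1 \<le> n \<and> real n \<le> x}"

(* A prime power p^k with k >= 1 is represented by the (unique) pair (p, k). *)
definition prime_powers_upto :: "real \<Rightarrow> (nat \<times> nat) set" where
  "prime_powers_upto x = {(p, k). prime p \<and> 1 \<le> k \<and> real (p ^ k) \<le> x}"

lemma finite_nats_upto: "finite (nats_upto x)"
proof (rule finite_subset)
  show "nats_upto x \<subseteq> {..nat \<lfloor>x\<rfloor>}"
    by (auto simp: nats_upto_def le_nat_floor)
qed simp

lemma finite_prime_powers_upto: "finite (prime_powers_upto x)"
proof (rule finite_subset)
  have "p \<le> nat \<lfloor>x\<rfloor> \<and> k \<le> nat \<lfloor>x\<rfloor>"
    if "prime p" "1 \<le> k" "real (p ^ k) \<le> x" for p k :: nat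
  proof -
    have "p ^ k \<le> nat \<lfloor>x\<rfloor>"
      using that(3) by (rule le_nat_floor)
    moreover have "p \<le> p ^ k"
      using that prime_gt_0_nat[of p] by (intro self_le_power) auto
    moreover have "k < p ^ k"
      using prime_gt_1_nat[OF that(1)] by (simp add: power_gt_expt)
    ultimately show ?thesis by linarith
  qed
  then show "prime_powers_upto x \<subseteq> {..nat \<lfloor>x\<rfloor>} \<times> {..nat \<lfloor>x\<rfloor>}"
    unfolding prime_powers_upto_def by blast
qed simp

definition S_sum :: "(nat \<Rightarrow> real) \<Rightarrow> real \<Rightarrow> real" where
  "S_sum \<alpha> x = (\<Sum>n\<in>nats_upto x. \<alpha> n)"

definition F_prod :: "(nat \<Rightarrow> real) \<Rightarrow> real \<Rightarrow> nat \<Rightarrow> real" where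
  "F_prod \<alpha> \<sigma> a =
     (\<Prod>p\<in>prime_factors a. \<Sum>k. \<alpha> (p ^ k) * real p powr (- (real k * \<sigma>)))"

definition A_mean :: "(nat \<Rightarrow> real) \<Rightarrow> (nat \<Rightarrow> complex) \<Rightarrow> real \<Rightarrow> real \<Rightarrow> complex" where
  "A_mean \<alpha> f \<sigma> x =
     (\<Sum>(p, k)\<in>prime_powers_upto x.
        of_real (\<alpha> (p ^ k) * inverse (F_prod \<alpha> \<sigma> p)) *
        (f (p ^ k) / of_real (real p powr (real k * \<sigma>))))"

definition B_var ::
  "(nat \<Rightarrow> real) \<Rightarrow> (nat \<Rightarrow> complex) \<Rightarrow> real \<Rightarrow> real \<Rightarrow> real \<Rightarrow> real" where
  "B_var \<alpha> f \<sigma> \<kappa> x =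
     (\<Sum>(p, k)\<in>prime_powers_upto x.
        \<alpha> (p ^ k) * ((cmod (f (p ^ k)))\<^sup>2 / real p powr (real k * \<sigma>)) *
        (1 - ln (real (p ^ k)) / ln (3 * x)) powr (min (\<kappa> - 1) 0))"

end

theory Submission
  imports Defs "HOL-Analysis.Complex_Transcendental"
begin

text \<open>
  Write \<open>w(q)\<close> for \<open>\<alpha>(q) / q\<^sup>\<sigma>\<close> and \<open>u(q)\<close> for \<open>ln q / ln (3x)\<close>, where \<open>q\<close> is a prime power. Prime
  powers \<open>q > x\<^sup>\<epsilon>\<close> contribute little: at most \<open>1/\<epsilon>\<close> of them divide an \<open>n \<le> x\<close> exactly, and the
  sum of their weights \<open>w(q)\<close> is bounded. For small prime powers the square is expanded into
  covariances of the indicators of exact divisibility. By the asymptotic formula the covariance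
  of powers \<open>q\<close> and \<open>r\<close> of distinct primes is at most \<open>w(q) w(r)\<close> times the second difference
  \<open>h(u(q) + u(r)) - h(u(q)) - h(u(r)) + h(0)\<close> of \<open>h(u) = (1 - u)\<close>\<open>\<^sup>\<kappa>\<^sup>-\<^sup>1\<close>, up to an error of relative
  size \<open>1 / ln ln (3x)\<close>. The second difference is \<open>O(u(q) u(r))\<close> and the weights \<open>w(q)\<close> sum to
  \<open>O(ln ln (3x))\<close>, so Cauchy-Schwarz controls both parts. A bound \<open>O(u(q) + u(r))\<close> instead would
  lose a factor \<open>(ln ln x)\<close>\<open>\<^sup>1\<^sup>/\<^sup>2\<close>.
\<close>

text \<open>The implied constant may depend on neither \<open>c\<close> nor \<open>\<sigma>\<close>,
  yet the variance is divided by \<open>S_sum \<alpha> x\<close>, and the asymptotic formula gives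
  no lower bound for that sum as long as \<open>K1 / ln (ln (3 * x))\<close> is not small. All
  estimates are therefore made against the main term \<open>main_size x\<close>, which is exchanged
  for \<open>S_sum \<alpha> x\<close> only at the end. For bounded \<open>x\<close> the exchange
  uses \<open>S_sum \<alpha> x \<ge> 1\<close> together with bounds for \<open>c\<close> and
  \<open>\<sigma>\<close> that come from the formula at and just above one fixed integer.

  Two different powers of the same prime never divide the same number exactly, so their covariance
  shows no cancellation. Moreover the weights of all powers of \<open>p\<close> add up to
  \<open>F_prod \<alpha> \<sigma> p - 1\<close>, for which no uniform bound is used. The factor
  \<open>1 / F_prod \<alpha> \<sigma> p\<close> in \<open>A_mean\<close> makes up for this: one copy
  of it is kept in the covariance bound, and the weights divided by it sum to at most 1 for each
  prime.\<close>

section \<open>Prime powers exactly dividing an integer\<close>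

definition exact_powers :: "nat \<Rightarrow> (nat \<times> nat) set" where
  "exact_powers n = (\<lambda>p. (p, multiplicity p n)) ` prime_factors n"

lemma finite_exact_powers [simp]: "finite (exact_powers n)"
  by (simp add: exact_powers_def)

lemma mem_exact_powers_iff:
  "(p, k) \<in> exact_powers n \<longleftrightarrow> prime p \<and> 1 \<le> k \<and> multiplicity p n = k"
  by (auto simp: exact_powers_def prime_factors_multiplicity)

lemma exact_powers_subset:
  assumes "n \<in> nats_upto x"
  shows "exact_powers n \<subseteq> prime_powers_upto x"
proof
  fix q assume q: "q \<in> exact_powers n"
  obtain p k where [simp]: "q = (p, k)" by (cases q)
  have pk: "prime p" "1 \<le> k" "multiplicity p n = k" using q by (auto simp: mem_exact_powers_iff)
  have "p ^ k dvd n" using pk(3) multiplicity_dvd by blast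
  moreover have n: "n \<ge> 1" "real n \<le> x" using assms by (auto simp: nats_upto_def)
  ultimately have "p ^ k \<le> n" by (intro dvd_imp_le) auto
  hence "real (p ^ k) \<le> x" using n by (meson of_nat_mono order_trans)
  thus "q \<in> prime_powers_upto x" using pk by (simp add: prime_powers_upto_def)
qed

text \<open>Stated for an arbitrary commutative monoid because it serves twice: for the
  complex-valued \<open>f\<close>, and for the real logarithm, by which large prime powers are
  counted.\<close>

lemma additive_sum_exact_powers:
  fixes g :: "nat \<Rightarrow> 'a :: comm_monoid_add"
  assumes g1: "g 1 = 0"
    and add: "\<And>m n. m > 0 \<Longrightarrow> n > 0 \<Longrightarrow> coprime m n \<Longrightarrow> g (m * n) = g m + g n"
    and n: "n > 0"
  shows "g n = (\<Sum>q\<in>exact_powers n. g (fst q ^ snd q))"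
proof -
  define e where "e p = multiplicity p n" for p
  have *: "g (\<Prod>p\<in>A. p ^ e p) = (\<Sum>p\<in>A. g (p ^ e p))"
    if "finite A" "\<And>p. p \<in> A \<Longrightarrow> prime p" for A
    using that
  proof (induction A rule: finite_induct)
    case empty
    thus ?case using g1 by simp
  next
    case (insert a A)
    have "coprime (a ^ e a) (\<Prod>p\<in>A. p ^ e p)"
      using insert by (intro prod_coprime_right)
        (metis coprime_power_left_iff coprime_power_right_iff insertCI primes_coprime)
    moreover have "a ^ e a > 0" "(\<Prod>p\<in>A. p ^ e p) > 0"
      using insert.prems prime_gt_0_nat by (auto intro!: prod_pos)
    ultimately have "g (a ^ e a * (\<Prod>p\<in>A. p ^ e p)) = g (a ^ e a) + g (\<Prod>p\<in>A. p ^ e p)"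
      by (intro add)
    thus ?case using insert by simp
  qed
  have "n = (\<Prod>p\<in>prime_factors n. p ^ e p)"
    using prime_factorization_nat[OF n] by (simp add: e_def)
  hence "g n = g (\<Prod>p\<in>prime_factors n. p ^ e p)" by simp
  also have "\<dots> = (\<Sum>p\<in>prime_factors n. g (p ^ e p))"
    by (intro *) auto
  also have "\<dots> = (\<Sum>q\<in>exact_powers n. g (fst q ^ snd q))"
    unfolding exact_powers_def by (subst sum.reindex) (auto simp: inj_on_def e_def)
  finally show ?thesis .
qed

lemma multiplicity_mult_eq_iff_coprime:
  fixes p d m k :: nat
  assumes "prime p" "d > 0" "m > 0" "multiplicity p d = k"
  shows "multiplicity p (d * m) = k \<longleftrightarrow> coprime m p"
proof -
  have "multiplicity p (d * m) = k + multiplicity p m"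
    using assms by (subst prime_elem_multiplicity_mult_distrib) auto
  moreover have "multiplicity p m = 0 \<longleftrightarrow> \<not> p dvd m"
    using assms by (metis not_gr_zero prime_imp_prime_elem prime_multiplicity_gt_zero_iff)
  moreover have "coprime m p \<longleftrightarrow> \<not> p dvd m"
    using assms(1) by (metis coprime_absorb_right coprime_commute not_prime_unit prime_imp_coprime)
  ultimately show ?thesis by simp
qed

section \<open>Sums over integers with prescribed exact prime powers\<close>

text \<open>In the applications \<open>d\<close> is the product of one or two prime powers and
  \<open>a\<close> the product of their primes. Writing \<open>n = d * m\<close> turns the exactness
  condition into coprimality of \<open>m\<close> to \<open>a\<close>, and multiplicativity splits
  off \<open>\<alpha> d\<close>.\<close>

lemma sum_multiples_exact:
  fixes \<alpha> :: "nat \<Rightarrow> real"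
  assumes mult: "multiplicative_function \<alpha>"
    and d: "d > 0"
    and dvd: "\<And>n. n > 0 \<Longrightarrow> P n \<Longrightarrow> d dvd n"
    and P: "\<And>m. m > 0 \<Longrightarrow> P (d * m) \<longleftrightarrow> coprime m a"
    and cop: "\<And>m. m > 0 \<Longrightarrow> coprime m a \<Longrightarrow> coprime m d"
  shows "(\<Sum>n\<in>nats_upto x. \<alpha> n * of_bool (P n))
           = \<alpha> d * (\<Sum>n\<in>{n \<in> nats_upto (x / real d). coprime n a}. \<alpha> n)"
proof -
  let ?A = "{n \<in> nats_upto (x / real d). coprime n a}"
  have eq: "{n \<in> nats_upto x. P n} = (\<lambda>m. d * m) ` ?A"
  proof (intro equalityI subsetI)
    fix n assume "n \<in> {n \<in> nats_upto x. P n}"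
    hence n: "n > 0" "real n \<le> x" "P n" by (auto simp: nats_upto_def)
    then obtain m where m: "n = d * m" using dvd by blast
    with n have "m > 0" by simp
    thus "n \<in> (\<lambda>m. d * m) ` ?A" using n d m P[of m]
      by (auto simp: nats_upto_def field_simps)
  next
    fix n assume "n \<in> (\<lambda>m. d * m) ` ?A"
    thus "n \<in> {n \<in> nats_upto x. P n}" using d P
      by (auto simp: nats_upto_def field_simps Suc_le_eq)
  qed
  have "(\<Sum>n\<in>nats_upto x. \<alpha> n * of_bool (P n)) = (\<Sum>n\<in>{n \<in> nats_upto x. P n}. \<alpha> n)"
    by (intro sum.mono_neutral_cong_right) (auto simp: finite_nats_upto)
  also have "\<dots> = (\<Sum>m\<in>?A. \<alpha> (d * m))"
    unfolding eq by (subst sum.reindex) (use d in \<open>auto simp: inj_on_def\<close>)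
  also have "\<dots> = (\<Sum>m\<in>?A. \<alpha> d * \<alpha> m)"
  proof (intro sum.cong refl)
    fix m assume "m \<in> ?A"
    hence "m > 0" "coprime d m" using cop[of m] by (auto simp: nats_upto_def coprime_commute)
    thus "\<alpha> (d * m) = \<alpha> d * \<alpha> m" using mult d by (auto simp: multiplicative_function_def)
  qed
  finally show ?thesis by (simp add: sum_distrib_left)
qed

lemma sum_exact_power:
  fixes \<alpha> :: "nat \<Rightarrow> real"
  assumes "multiplicative_function \<alpha>" "prime p" "k \<ge> 1"
  shows "(\<Sum>n\<in>nats_upto x. \<alpha> n * of_bool ((p, k) \<in> exact_powers n))
           = \<alpha> (p ^ k) * (\<Sum>n\<in>{n \<in> nats_upto (x / real (p ^ k)). coprime n p}. \<alpha> n)"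
proof (rule sum_multiples_exact)
  show "p ^ k > 0" using assms prime_gt_0_nat by simp
  show "p ^ k dvd n" if "(p, k) \<in> exact_powers n" for n
    using that by (metis mem_exact_powers_iff multiplicity_dvd)
  show "(p, k) \<in> exact_powers (p ^ k * m) \<longleftrightarrow> coprime m p" if "m > 0" for m
    using multiplicity_mult_eq_iff_coprime[of p "p ^ k" m k] assms that prime_gt_0_nat[of p]
    by (simp add: mem_exact_powers_iff)
qed (use assms in auto)

lemma sum_two_exact_powers:
  fixes \<alpha> :: "nat \<Rightarrow> real"
  assumes "multiplicative_function \<alpha>" "prime p" "k \<ge> 1" "prime r" "l \<ge> 1" "p \<noteq> r"
  shows "(\<Sum>n\<in>nats_upto x. \<alpha> n * of_bool ((p, k) \<in> exact_powers n \<and> (r, l) \<in> exact_powers n))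
           = \<alpha> (p ^ k) * \<alpha> (r ^ l) *
             (\<Sum>n\<in>{n \<in> nats_upto (x / (real (p ^ k) * real (r ^ l))). coprime n (p * r)}. \<alpha> n)"
proof -
  have cop: "coprime (p ^ k) (r ^ l)"
    using assms by (simp add: primes_coprime)
  have pos: "p ^ k > 0" "r ^ l > 0" using assms prime_gt_0_nat by simp_all
  have "multiplicity p (p ^ k * r ^ l) = k" "multiplicity r (p ^ k * r ^ l) = l"
    using assms pos
    by (simp_all add: prime_elem_multiplicity_mult_distrib multiplicity_distinct_prime_power)
  hence "(p, k) \<in> exact_powers (p ^ k * r ^ l * m) \<and> (r, l) \<in> exact_powers (p ^ k * r ^ l * m)
      \<longleftrightarrow> coprime m (p * r)" if "m > 0" for m
    using multiplicity_mult_eq_iff_coprime[of p "p ^ k * r ^ l" m k]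
      multiplicity_mult_eq_iff_coprime[of r "p ^ k * r ^ l" m l] assms that pos
    by (simp add: mem_exact_powers_iff coprime_mult_right_iff)
  moreover have "p ^ k * r ^ l dvd n"
    if "(p, k) \<in> exact_powers n \<and> (r, l) \<in> exact_powers n" for n
    using that cop by (intro divides_mult) (metis mem_exact_powers_iff multiplicity_dvd)+
  ultimately have "(\<Sum>n\<in>nats_upto x. \<alpha> n * of_bool ((p, k) \<in> exact_powers n \<and> (r, l) \<in> exact_powers n))
      = \<alpha> (p ^ k * r ^ l) *
        (\<Sum>n\<in>{n \<in> nats_upto (x / real (p ^ k * r ^ l)). coprime n (p * r)}. \<alpha> n)"
    using assms(1) pos by (intro sum_multiples_exact) auto
  moreover have "\<alpha> (p ^ k * r ^ l) = \<alpha> (p ^ k) * \<alpha> (r ^ l)"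
    using assms(1) pos cop by (auto simp: multiplicative_function_def)
  ultimately show ?thesis by simp
qed

section \<open>Hypotheses, local weights and Euler factors\<close>

text \<open>The final constant may depend on \<open>\<kappa>\<close>, \<open>\<delta>\<close>,
  \<open>K1\<close> and \<open>K2\<close> only. The constants defined below involve no other
  parameters, so outside the locale they are functions of these four.\<close>

locale weighted_asymptotics =
  fixes \<alpha> :: "nat \<Rightarrow> real" and c \<sigma> \<kappa> \<delta> K1 K2 :: real
  assumes mult: "multiplicative_function \<alpha>"
    and nonneg: "n \<ge> 1 \<Longrightarrow> \<alpha> n \<ge> 0"
    and c_pos: "c > 0" and \<sigma>_nonneg: "\<sigma> \<ge> 0" and \<delta>_pos: "\<delta> > 0"
    and summable_F: "prime p \<Longrightarrow> summable (\<lambda>k. \<alpha> (p ^ k) * real p powr (- (real k * \<sigma>)))"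
    and asymp: "x \<ge> 1 \<Longrightarrow> a \<ge> 1 \<Longrightarrow> real a \<le> x powr \<delta> \<Longrightarrow> squarefree a \<Longrightarrow>
       card (prime_factors a) \<le> 2 \<Longrightarrow>
       \<exists>E. \<bar>E\<bar> \<le> K1 * (1 / ln (ln (3 * x))) \<and>
         (\<Sum>n\<in>{n \<in> nats_upto x. coprime n a}. \<alpha> n) =
           c * x powr \<sigma> * ln (3 * x) powr (\<kappa> - 1) * (inverse (F_prod \<alpha> \<sigma> a) + E)"
    and chebyshev: "x \<ge> 2 \<Longrightarrow> (\<Sum>(p, k)\<in>prime_powers_upto x.
         \<alpha> (p ^ k) / real p powr (real k * \<sigma>) * ln (real (p ^ k))) \<le> K2 * ln x"
begin

definition coprime_sum :: "real \<Rightarrow> nat \<Rightarrow> real" where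
  "coprime_sum x a = (\<Sum>n\<in>{n \<in> nats_upto x. coprime n a}. \<alpha> n)"

definition main_size :: "real \<Rightarrow> real" where
  "main_size x = c * x powr \<sigma> * ln (3 * x) powr (\<kappa> - 1)"

definition pp_weight :: "nat \<times> nat \<Rightarrow> real" where
  "pp_weight q = \<alpha> (fst q ^ snd q) / real (fst q) powr (real (snd q) * \<sigma>)"

abbreviation pp_val :: "nat \<times> nat \<Rightarrow> real" where
  "pp_val q \<equiv> real (fst q ^ snd q)"

abbreviation euler_factor :: "nat \<Rightarrow> real" where
  "euler_factor p \<equiv> F_prod \<alpha> \<sigma> p"


lemma prime_powers_uptoD:
  assumes "q \<in> prime_powers_upto x"
  shows "prime (fst q)" "snd q \<ge> 1" "pp_val q \<le> x" "pp_val q \<ge> 2" "x \<ge> 2"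
    "real (fst q) \<le> pp_val q"
proof -
  show q: "prime (fst q)" "snd q \<ge> 1" "pp_val q \<le> x"
    using assms by (auto simp: prime_powers_upto_def)
  have "fst q \<le> fst q ^ snd q"
    using q prime_gt_0_nat by (intro self_le_power) (auto simp: Suc_le_eq)
  thus "real (fst q) \<le> pp_val q" by (rule of_nat_mono)
  moreover have "2 \<le> real (fst q)" using prime_ge_2_nat[OF q(1)] by simp
  ultimately show "pp_val q \<ge> 2" by linarith
  thus "x \<ge> 2" using q by linarith
qed

lemma prime_powers_upto_mono: "x \<le> y \<Longrightarrow> prime_powers_upto x \<subseteq> prime_powers_upto y"
  by (auto simp: prime_powers_upto_def)

lemma lnln3_pos: "ln (ln 3) > (0 :: real)"
  using ln3_gt_1 by simp

lemma lnln_ge: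
  fixes x :: real
  assumes "x \<ge> 1"
  shows "ln (ln (3 * x)) \<ge> ln (ln 3)" "ln (3 * x) \<ge> 1" "ln (3 * x) > 0" "ln (ln (3 * x)) > 0"
proof -
  have *: "ln (3 * x) \<ge> ln 3" using assms by simp
  show "ln (3 * x) \<ge> 1" using * ln3_gt_1 by linarith
  thus "ln (3 * x) > 0" by linarith
  show "ln (ln (3 * x)) \<ge> ln (ln 3)" using * ln3_gt_1 by simp
  thus "ln (ln (3 * x)) > 0" using lnln3_pos by linarith
qed

lemma K1_nonneg: "K1 \<ge> 0"
proof -
  obtain E where "\<bar>E\<bar> \<le> K1 * (1 / ln (ln (3 * 1)))" using asymp[of 1 1] by auto
  hence "0 \<le> K1 * (1 / ln (ln 3))" by simp
  thus ?thesis using lnln3_pos by (simp add: zero_le_divide_iff)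
qed

lemma pp_weight_nonneg: "prime (fst q) \<Longrightarrow> pp_weight q \<ge> 0"
  unfolding pp_weight_def by (intro divide_nonneg_nonneg nonneg) (auto simp: Suc_le_eq prime_gt_0_nat)

lemma sum_pp_weight_ln:
  assumes "x \<ge> 2"
  shows "(\<Sum>q\<in>prime_powers_upto x. pp_weight q * ln (pp_val q)) \<le> K2 * ln x"
  using chebyshev[OF assms] by (simp add: pp_weight_def case_prod_unfold)

lemma K2_nonneg: "K2 \<ge> 0"
proof -
  have "0 \<le> (\<Sum>q\<in>prime_powers_upto 2. pp_weight q * ln (pp_val q))"
  proof (intro sum_nonneg mult_nonneg_nonneg)
    fix q assume "q \<in> prime_powers_upto 2"
    from prime_powers_uptoD[OF this] show "pp_weight q \<ge> 0" "ln (pp_val q) \<ge> 0"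
      by (auto intro: pp_weight_nonneg)
  qed
  hence "0 \<le> K2 * ln 2" using sum_pp_weight_ln[of 2] by simp
  thus ?thesis by (simp add: zero_le_mult_iff)
qed

text \<open>The Chebyshev hypothesis is taken at \<open>x = pp_val q\<close> and only the term of
  \<open>q\<close> itself is kept; there \<open>ln x\<close> and \<open>ln (pp_val q)\<close>
  cancel.\<close>

lemma pp_weight_le:
  assumes "prime (fst q)" "snd q \<ge> 1"
  shows "pp_weight q \<le> K2"
proof -
  have q: "q \<in> prime_powers_upto (pp_val q)"
    using assms by (auto simp: prime_powers_upto_def case_prod_unfold)
  note D = prime_powers_uptoD[OF q]
  have "pp_weight q * ln (pp_val q) \<le> (\<Sum>q\<in>prime_powers_upto (pp_val q). pp_weight q * ln (pp_val q))"
  proof (rule member_le_sum[OF q])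
    fix r assume "r \<in> prime_powers_upto (pp_val q) - {q}"
    hence "r \<in> prime_powers_upto (pp_val q)" by simp
    from prime_powers_uptoD[OF this] show "pp_weight r * ln (pp_val r) \<ge> 0"
      by (intro mult_nonneg_nonneg pp_weight_nonneg) auto
  qed (simp add: finite_prime_powers_upto)
  also have "\<dots> \<le> K2 * ln (pp_val q)" using D by (intro sum_pp_weight_ln) auto
  finally have "pp_weight q * ln (pp_val q) \<le> K2 * ln (pp_val q)" .
  moreover have "ln (pp_val q) > 0" using D(4) by (intro ln_gt_zero) linarith
  ultimately show ?thesis by (simp only: mult_le_cancel_right_pos)
qed

lemma euler_factor_prime:
  assumes "prime p"
  shows "euler_factor p = (\<Sum>k. \<alpha> (p ^ k) * real p powr (- (real k * \<sigma>)))"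
  using assms by (simp add: F_prod_def prime_factorization_prime)

lemma euler_factor_mult:
  assumes "prime p" "prime r" "p \<noteq> r"
  shows "euler_factor (p * r) = euler_factor p * euler_factor r"
  using assms by (simp add: F_prod_def prime_factors_product prime_factorization_prime)

lemma euler_factor_1 [simp]: "euler_factor (Suc 0) = 1"
  by (simp add: F_prod_def)

text \<open>The 1 is the term of exponent 0 in the Euler factor. The empty set gives
  \<open>euler_factor p \<ge> 1\<close>; the set of all small powers of \<open>p\<close> gives the
  row sums for pairs of powers of one prime.\<close>

lemma sum_weights_le_euler_factor:
  assumes p: "prime p" and "finite A" and A: "\<And>q. q \<in> A \<Longrightarrow> fst q = p \<and> snd q \<ge> 1"
  shows "1 + (\<Sum>q\<in>A. pp_weight q) \<le> euler_factor p"
proof -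
  let ?g = "\<lambda>k. \<alpha> (p ^ k) * real p powr (- (real k * \<sigma>))"
  have "(\<Sum>q\<in>A. pp_weight q) = (\<Sum>q\<in>A. ?g (snd q))"
    using A by (intro sum.cong) (auto simp: pp_weight_def powr_minus divide_inverse)
  also have "\<dots> = (\<Sum>k\<in>snd ` A. ?g k)"
    using A by (subst sum.reindex) (auto simp: inj_on_def prod_eq_iff)
  finally have *: "(\<Sum>q\<in>A. pp_weight q) = (\<Sum>k\<in>snd ` A. ?g k)" .
  have A0: "0 \<notin> snd ` A" using A by force
  have "1 + (\<Sum>q\<in>A. pp_weight q) = (\<Sum>k\<in>insert 0 (snd ` A). ?g k)"
    using A0 assms(2) p mult by (subst sum.insert) (auto simp: multiplicative_function_def *)
  also have "\<dots> \<le> (\<Sum>k. ?g k)"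
    using p assms(2) by (intro sum_le_suminf summable_F mult_nonneg_nonneg nonneg)
      (auto simp: Suc_le_eq prime_gt_0_nat)
  finally show ?thesis using euler_factor_prime[OF p] by simp
qed

lemma euler_factor_ge_1: "prime p \<Longrightarrow> euler_factor p \<ge> 1"
  using sum_weights_le_euler_factor[of p "{}"] by simp

lemma inverse_euler_factor_bounds:
  assumes "prime p"
  shows "inverse (euler_factor p) \<ge> 0" "inverse (euler_factor p) \<le> 1"
  using euler_factor_ge_1[OF assms] by (auto simp: inverse_le_1_iff)

section \<open>The summatory function and its main term\<close>

lemma S_sum_eq: "S_sum \<alpha> x = coprime_sum x 1"
  by (simp add: S_sum_def coprime_sum_def)

lemma coprime_sum_bounds: "0 \<le> coprime_sum x a" "coprime_sum x a \<le> S_sum \<alpha> x"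
  unfolding coprime_sum_def S_sum_def
  by (intro sum_nonneg sum_mono2 nonneg finite_nats_upto; auto simp: nats_upto_def intro: nonneg)+

lemma S_sum_ge_1:
  assumes "x \<ge> 1"
  shows "S_sum \<alpha> x \<ge> 1"
proof -
  have "\<alpha> 1 \<le> S_sum \<alpha> x" unfolding S_sum_def
    using assms by (intro member_le_sum finite_nats_upto) (auto simp: nats_upto_def intro: nonneg)
  thus ?thesis using mult by (simp add: multiplicative_function_def)
qed

lemma main_size_pos: "x \<ge> 1 \<Longrightarrow> main_size x > 0"
  using c_pos lnln_ge[of x] unfolding main_size_def by (intro mult_pos_pos) auto

lemma S_sum_asymp:
  assumes "x \<ge> 1"
  obtains E where "\<bar>E\<bar> \<le> K1 / ln (ln (3 * x))" "S_sum \<alpha> x = main_size x * (1 + E)"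
  using asymp[of x 1] assms ge_one_powr_ge_zero[of x \<delta>] \<delta>_pos that
  by (auto simp: S_sum_eq coprime_sum_def main_size_def)

lemma S_sum_upper:
  assumes "x \<ge> 1"
  shows "S_sum \<alpha> x \<le> (1 + K1 / ln (ln 3)) * main_size x"
proof -
  obtain E where E: "\<bar>E\<bar> \<le> K1 / ln (ln (3 * x))" "S_sum \<alpha> x = main_size x * (1 + E)"
    using S_sum_asymp[OF assms] .
  have "E \<le> K1 / ln (ln (3 * x))" using E(1) by linarith
  also have "\<dots> \<le> K1 / ln (ln 3)"
    using lnln_ge[OF assms] lnln3_pos K1_nonneg by (intro divide_left_mono mult_pos_pos)
  finally have "main_size x * (1 + E) \<le> main_size x * (1 + K1 / ln (ln 3))"
    using main_size_pos[OF assms] by (intro mult_left_mono) auto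
  thus ?thesis using E(2) by (simp add: mult.commute)
qed

text \<open>The origin of \<open>h(u) = (1 - u) powr (\<kappa> - 1)\<close>: dividing
  \<open>x\<close> by \<open>d\<close> multiplies \<open>ln (3 * x)\<close> by \<open>1 - u\<close>
  with \<open>u = ln d / ln (3 * x)\<close>. The 3 keeps \<open>1 - u\<close> positive even at
  \<open>d = x\<close>.\<close>

lemma main_size_divide:
  assumes "1 \<le> d" "d \<le> x"
  shows "main_size (x / d) = main_size x * d powr (- \<sigma>) * (1 - ln d / ln (3 * x)) powr (\<kappa> - 1)"
proof -
  have x: "x \<ge> 1" using assms by linarith
  have L: "ln (3 * x) > 0" using lnln_ge[OF x] by simp
  have "ln (3 * (x / d)) = ln (3 * x) - ln d"
    using assms x by (simp add: ln_div)
  also have "\<dots> = ln (3 * x) * (1 - ln d / ln (3 * x))" using L by (simp add: field_simps)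
  finally have *: "ln (3 * (x / d)) = ln (3 * x) * (1 - ln d / ln (3 * x))" .
  have "ln d < ln (3 * x)" using assms by (subst ln_less_cancel_iff) auto
  hence "1 - ln d / ln (3 * x) \<ge> 0" using L by (simp add: field_simps)
  hence "ln (3 * (x / d)) powr (\<kappa> - 1)
      = ln (3 * x) powr (\<kappa> - 1) * (1 - ln d / ln (3 * x)) powr (\<kappa> - 1)"
    unfolding * by (intro powr_mult)
  moreover have "(x / d) powr \<sigma> = x powr \<sigma> * d powr (- \<sigma>)"
    using assms by (simp add: powr_divide powr_minus_divide)
  ultimately show ?thesis by (simp add: main_size_def)
qed

lemma pp_weight_alt:
  assumes "prime (fst q)"
  shows "\<alpha> (fst q ^ snd q) * pp_val q powr (- \<sigma>) = pp_weight q"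
proof -
  have "pp_val q powr \<sigma> = real (fst q) powr (real (snd q) * \<sigma>)"
    using prime_gt_0_nat[OF assms] by (simp add: powr_powr flip: powr_realpow)
  thus ?thesis by (simp add: pp_weight_def powr_minus divide_inverse)
qed

text \<open>This must hold for all \<open>q\<close> up to \<open>x\<close>, also when
  \<open>x / pp_val q\<close> is too small for the asymptotic formula with \<open>a = fst q\<close>.
  Hence the coprimality condition is dropped and only the case \<open>a = 1\<close> is used, which
  loses the factor \<open>1 / euler_factor (fst q)\<close>.\<close>

lemma sum_exact_power_upper:
  assumes q: "q \<in> prime_powers_upto x"
  shows "(\<Sum>n\<in>nats_upto x. \<alpha> n * of_bool (q \<in> exact_powers n))
    \<le> (1 + K1 / ln (ln 3)) * main_size x *
       (pp_weight q * (1 - ln (pp_val q) / ln (3 * x)) powr (\<kappa> - 1))"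
proof -
  note D = prime_powers_uptoD[OF q]
  have "(\<Sum>n\<in>nats_upto x. \<alpha> n * of_bool (q \<in> exact_powers n))
      = \<alpha> (fst q ^ snd q) * coprime_sum (x / pp_val q) (fst q)"
    using sum_exact_power[OF mult D(1,2), of x] by (simp add: coprime_sum_def)
  also have "\<dots> \<le> \<alpha> (fst q ^ snd q) * ((1 + K1 / ln (ln 3)) * main_size (x / pp_val q))"
    using D coprime_sum_bounds(2)[of "x / pp_val q" "fst q"] S_sum_upper[of "x / pp_val q"]
    by (intro mult_left_mono nonneg) (auto simp: Suc_le_eq prime_gt_0_nat field_simps)
  also have "\<dots> = (1 + K1 / ln (ln 3)) * main_size x *
       ((\<alpha> (fst q ^ snd q) * pp_val q powr (- \<sigma>)) * (1 - ln (pp_val q) / ln (3 * x)) powr (\<kappa> - 1))"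
    using D by (subst main_size_divide) auto
  also have "\<alpha> (fst q ^ snd q) * pp_val q powr (- \<sigma>) = pp_weight q"
    using D by (intro pp_weight_alt) auto
  finally show ?thesis .
qed

section \<open>Growth of the sum of the weights\<close>

text \<open>A square root halves the exponent \<open>2 ^ n\<close>, and for \<open>q\<close> between
  \<open>sqrt x\<close> and \<open>x\<close> the logarithm of \<open>q\<close> exceeds
  \<open>ln x / 2\<close>, so by the Chebyshev hypothesis these \<open>q\<close> contribute at most
  \<open>2 * K2\<close>. After \<open>n\<close> square roots at most \<open>q = 2\<close> is
  left.\<close>

lemma sum_pp_weight_upto_double_power:
  assumes "x \<le> 2 ^ (2 ^ n)"
  shows "(\<Sum>q\<in>prime_powers_upto x. pp_weight q) \<le> K2 * (1 + 2 * real n)"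
  using assms
proof (induction n arbitrary: x)
  case 0
  show ?case
  proof (cases "prime_powers_upto x = {}")
    case True
    thus ?thesis using K2_nonneg by simp
  next
    case False
    have "q = (2, 1)" if "q \<in> prime_powers_upto x" for q
    proof -
      note D = prime_powers_uptoD[OF that]
      have "fst q \<ge> 2" using prime_ge_2_nat[OF D(1)] .
      moreover have "real (fst q) \<le> 2" using order_trans[OF D(6,3)] 0 by simp
      ultimately have "fst q = 2" by simp
      have "snd q < 2 ^ snd q" by (rule less_exp)
      moreover have "fst q ^ snd q \<le> 2"
        using D(3) 0 by (metis of_nat_le_iff of_nat_numeral order_trans power_0 power_one_right)
      ultimately have "snd q < 2" using \<open>fst q = 2\<close> by (metis less_le_trans)
      hence "snd q = 1" using D(2) by linarith
      thus ?thesis using \<open>fst q = 2\<close> by (simp add: prod_eq_iff)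
    qed
    with False have "prime_powers_upto x = {(2, 1)}" by blast
    thus ?thesis using pp_weight_le[of "(2, 1)"] by simp
  qed
next
  case (Suc n)
  show ?case
  proof (cases "x \<ge> 2")
    case False
    hence "prime_powers_upto x = {}" using prime_powers_uptoD(5) by blast
    thus ?thesis using K2_nonneg by simp
  next
    case x: True
    have sq: "sqrt x \<le> 2 ^ (2 ^ n)"
      using Suc.prems by (intro real_le_lsqrt) (auto simp: power_mult [symmetric] mult.commute)
    have "sqrt x \<le> x" using x by (intro real_le_lsqrt) (auto simp: power2_eq_square)
    let ?A = "prime_powers_upto (sqrt x)" and ?B = "prime_powers_upto x"
    have sub: "?A \<subseteq> ?B" using \<open>sqrt x \<le> x\<close> by (rule prime_powers_upto_mono)
    have lnx: "ln x > 0" using x by simp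
    have "(\<Sum>q\<in>?B - ?A. pp_weight q) \<le> (\<Sum>q\<in>?B - ?A. pp_weight q * ln (pp_val q) * (2 / ln x))"
    proof (intro sum_mono)
      fix q assume q: "q \<in> ?B - ?A"
      hence qB: "q \<in> ?B" by simp
      note D = prime_powers_uptoD[OF qB]
      have "pp_val q > sqrt x" using q D by (auto simp: prime_powers_upto_def case_prod_unfold)
      hence "ln (pp_val q) \<ge> ln (sqrt x)" using x D(4) by (subst ln_le_cancel_iff) (simp, linarith, linarith)
      hence "1 \<le> ln (pp_val q) * (2 / ln x)" using x lnx by (simp add: ln_sqrt field_simps)
      from mult_left_mono[OF this pp_weight_nonneg[OF D(1)]]
      show "pp_weight q \<le> pp_weight q * ln (pp_val q) * (2 / ln x)" by simp
    qed
    also have "\<dots> = (\<Sum>q\<in>?B - ?A. pp_weight q * ln (pp_val q)) * (2 / ln x)"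
      by (rule sum_distrib_right[symmetric])
    also have "\<dots> \<le> (\<Sum>q\<in>?B. pp_weight q * ln (pp_val q)) * (2 / ln x)"
    proof (intro mult_right_mono sum_mono2)
      fix q assume "q \<in> ?B - (?B - ?A)"
      hence "q \<in> ?B" by simp
      from prime_powers_uptoD[OF this] show "pp_weight q * ln (pp_val q) \<ge> 0"
        by (intro mult_nonneg_nonneg pp_weight_nonneg) auto
    qed (use lnx in \<open>auto simp: finite_prime_powers_upto\<close>)
    also have "\<dots> \<le> K2 * ln x * (2 / ln x)"
      using sum_pp_weight_ln[OF x] lnx by (intro mult_right_mono) auto
    also have "\<dots> = 2 * K2" using lnx by simp
    finally have "(\<Sum>q\<in>?B - ?A. pp_weight q) \<le> 2 * K2" .
    moreover have "(\<Sum>q\<in>?B. pp_weight q) = (\<Sum>q\<in>?B - ?A. pp_weight q) + (\<Sum>q\<in>?A. pp_weight q)"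
      by (rule sum.subset_diff[OF sub finite_prime_powers_upto])
    ultimately show ?thesis using Suc.IH[OF sq] by (simp add: algebra_simps)
  qed
qed

text \<open>The 5 is \<open>1 + 2 * 2\<close>: one unit of \<open>n\<close> is lost by rounding up
  and one by replacing e by \<open>4 = 2 ^ 2\<close>. Dividing it by \<open>ln (ln 3)\<close>, the
  least value of \<open>ln (ln (3 * x))\<close>, lets it be absorbed.\<close>

definition loglog_const :: real where
  "loglog_const = K2 * (5 / ln (ln 3) + 2 / ln 2)"

lemma loglog_const_nonneg: "loglog_const \<ge> 0"
  using K2_nonneg lnln3_pos by (auto simp: loglog_const_def intro!: mult_nonneg_nonneg add_nonneg_nonneg)

lemma sum_pp_weight_upper:
  assumes x: "x \<ge> 1"
  shows "(\<Sum>q\<in>prime_powers_upto x. pp_weight q) \<le> loglog_const * ln (ln (3 * x))"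
proof -
  note L = lnln_ge[OF x]
  define l where "l = ln (ln (3 * x))"
  have l: "l > 0" "l \<ge> ln (ln 3)" using L by (auto simp: l_def)
  define n where "n = nat \<lceil>l / ln 2\<rceil>"
  have "l / ln 2 \<ge> 0" using l by simp
  hence n: "real n \<ge> l / ln 2" "real n \<le> l / ln 2 + 1"
    unfolding n_def by linarith+
  have "l \<le> real n * ln 2" using n(1) by (simp add: field_simps)
  hence "ln (ln (3 * x)) \<le> ln (2 ^ n)" by (simp add: ln_realpow l_def)
  hence "ln (3 * x) \<le> 2 ^ n" using L by (subst (asm) ln_le_cancel_iff) auto
  hence "exp (ln (3 * x)) \<le> exp (real (2 ^ n) * 1)" by simp
  hence "3 * x \<le> exp 1 ^ (2 ^ n)" using x by (simp only: exp_of_nat_mult) simp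
  also have "\<dots> \<le> 4 ^ (2 ^ n)" using exp_le by (intro power_mono) auto
  also have "(4 :: real) ^ (2 ^ n) = 2 ^ (2 ^ Suc n)"
    by (simp add: power_mult)
  finally have "x \<le> 2 ^ (2 ^ Suc n)" using x by linarith
  hence "(\<Sum>q\<in>prime_powers_upto x. pp_weight q) \<le> K2 * (1 + 2 * real (Suc n))"
    by (rule sum_pp_weight_upto_double_power)
  also have "\<dots> \<le> K2 * (5 + 2 * (l / ln 2))"
    using n K2_nonneg by (intro mult_left_mono) auto
  also have "\<dots> \<le> K2 * (5 * (l / ln (ln 3)) + 2 * (l / ln 2))"
  proof -
    have "1 \<le> l / ln (ln 3)" using l lnln3_pos by simp
    thus ?thesis using K2_nonneg by (intro mult_left_mono add_mono) auto
  qed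
  also have "\<dots> = loglog_const * l" by (simp add: loglog_const_def algebra_simps)
  finally show ?thesis by (simp add: l_def)
qed

section \<open>Lower bound for the summatory function, uniform in \<open>c\<close> and
  \<open>\<sigma>\<close>\<close>

text \<open>A crude bound free of \<open>c\<close>, used only up to one fixed integer. Each exact
  prime power contributes at most \<open>1 + K2\<close> besides its value to the power
  \<open>\<sigma>\<close>, and counting these factors by \<open>n\<close> is generous.\<close>

lemma \<alpha>_upper:
  assumes "n \<ge> 1"
  shows "\<alpha> n \<le> (1 + K2) ^ n * real n powr \<sigma>"
  using assms
proof (induction n rule: less_induct)
  case (less n)
  show ?case
  proof (cases "n = 1")
    case True
    thus ?thesis using mult K2_nonneg by (simp add: multiplicative_function_def)
  next
    case False
    then obtain p where p: "prime p" "p dvd n" using prime_factor_nat by blast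
    define k where "k = multiplicity p n"
    obtain m where m: "n = p ^ k * m" "\<not> p dvd m"
      unfolding k_def using multiplicity_decompose'[of n p] less.prems p
      by (metis not_one_le_zero not_prime_unit)
    have k: "k \<ge> 1" unfolding k_def using p less.prems
      by (simp add: Suc_le_eq prime_multiplicity_gt_zero_iff)
    have m1: "m \<ge> 1" using m less.prems by (cases m) auto
    have pk: "p ^ k \<ge> 2"
      using prime_ge_2_nat[OF p(1)] k
      by (metis One_nat_def le_trans self_le_power Suc_le_eq Suc_1 less_imp_le pos2 less_le_trans)
    \<comment> \<open>This pays for the one factor \<open>1 + K2\<close> spent on
      \<open>p ^ k\<close>.\<close>
    have mn: "m + 1 \<le> n"
    proof -
      have "m + 1 \<le> 2 * m" using m1 by simp
      also have "\<dots> \<le> n" unfolding m(1) using pk by (rule mult_right_mono) simp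
      finally show ?thesis .
    qed
    have cop: "coprime (p ^ k) m" using p m by (simp add: prime_imp_coprime)
    have w: "pp_weight (p, k) \<le> K2" using p k by (intro pp_weight_le) auto
    have "\<alpha> (p ^ k) = pp_weight (p, k) * real (p ^ k) powr \<sigma>"
      using pp_weight_alt[of "(p, k)"] p pk prime_gt_0_nat[OF p(1)]
      by (auto simp: powr_minus field_simps)
    also have "\<dots> \<le> (1 + K2) * real (p ^ k) powr \<sigma>"
      using w by (intro mult_right_mono) auto
    finally have 1: "\<alpha> (p ^ k) \<le> (1 + K2) * real (p ^ k) powr \<sigma>" .
    have 2: "\<alpha> m \<le> (1 + K2) ^ m * real m powr \<sigma>"
      using mn m1 by (intro less.IH) auto
    have "\<alpha> n = \<alpha> (p ^ k) * \<alpha> m"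
      using mult cop pk m1 m(1) unfolding multiplicative_function_def by (metis less_le_trans pos2 zero_less_one)
    also have "\<dots> \<le> ((1 + K2) * real (p ^ k) powr \<sigma>) * ((1 + K2) ^ m * real m powr \<sigma>)"
      using 1 2 m1 K2_nonneg by (intro mult_mono nonneg mult_nonneg_nonneg) auto
    also have "\<dots> = (1 + K2) ^ (m + 1) * real n powr \<sigma>"
      using m(1) by (simp add: powr_mult)
    also have "\<dots> \<le> (1 + K2) ^ n * real n powr \<sigma>"
      using mn K2_nonneg by (intro mult_right_mono power_increasing) auto
    finally show ?thesis .
  qed
qed

lemma S_sum_nat_upper:
  assumes "N \<ge> 1"
  shows "S_sum \<alpha> (real N) \<le> real N * ((1 + K2) ^ N * real N powr \<sigma>)"
proof -
  have "S_sum \<alpha> (real N) \<le> (\<Sum>n\<in>nats_upto (real N). (1 + K2) ^ N * real N powr \<sigma>)"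
    unfolding S_sum_def
  proof (rule sum_mono)
    fix n assume "n \<in> nats_upto (real N)"
    hence n: "1 \<le> n" "n \<le> N" by (auto simp: nats_upto_def)
    have "\<alpha> n \<le> (1 + K2) ^ n * real n powr \<sigma>" by (rule \<alpha>_upper[OF n(1)])
    also have "\<dots> \<le> (1 + K2) ^ N * real N powr \<sigma>"
      using n K2_nonneg \<sigma>_nonneg by (intro mult_mono power_increasing powr_mono2) auto
    finally show "\<alpha> n \<le> \<dots>" .
  qed
  also have "nats_upto (real N) = {1..N}" by (auto simp: nats_upto_def)
  finally show ?thesis by simp
qed

lemma S_sum_large:
  assumes X: "X \<ge> 1" "K1 / ln (ln (3 * X)) \<le> 1 / 2" and x: "x \<ge> X"
  shows "main_size x \<le> 2 * S_sum \<alpha> x" "S_sum \<alpha> x \<le> 3 / 2 * main_size x"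
proof -
  have x1: "x \<ge> 1" using assms by linarith
  obtain E where E: "\<bar>E\<bar> \<le> K1 / ln (ln (3 * x))" "S_sum \<alpha> x = main_size x * (1 + E)"
    using S_sum_asymp[OF x1] .
  have "ln (3 * X) \<le> ln (3 * x)" using X x by simp
  hence "ln (ln (3 * X)) \<le> ln (ln (3 * x))" using lnln_ge[OF X(1)] by simp
  hence "K1 / ln (ln (3 * x)) \<le> K1 / ln (ln (3 * X))"
    using lnln_ge[OF X(1)] lnln_ge[OF x1] K1_nonneg by (intro divide_left_mono) auto
  hence "\<bar>E\<bar> \<le> 1 / 2" using E X by linarith
  hence "1 / 2 \<le> 1 + E" "1 + E \<le> 3 / 2" by (auto simp: abs_le_iff)
  from this[THEN mult_left_mono, of "main_size x"]
  show "main_size x \<le> 2 * S_sum \<alpha> x" "S_sum \<alpha> x \<le> 3 / 2 * main_size x"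
    using E(2) main_size_pos[OF x1] by auto
qed

text \<open>Because \<open>S_sum \<alpha>\<close> is constant on \<open>[N, N + 1)\<close> while \<open>x powr \<sigma>\<close> is not, the asymptotic
  formula bounds the exponent \<open>\<sigma>\<close>. This makes the final constant independent of \<open>\<sigma>\<close>.\<close>

lemma \<sigma>_upper:
  assumes X: "X \<ge> 1" "K1 / ln (ln (3 * X)) \<le> 1 / 2" and N: "real N \<ge> X"
  shows "\<sigma> \<le> ln (3 * (ln (3 * real N) / ln (3 * (real N + 1 / 2))) powr (\<kappa> - 1)) / ln (1 + 1 / (2 * real N))"
proof -
  let ?y = "real N + 1 / 2"
  let ?D = "(ln (3 * real N) / ln (3 * ?y)) powr (\<kappa> - 1)"
  have N1: "real N \<ge> 1" using X N by linarith
  have "nats_upto ?y = nats_upto (real N)"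
    by (auto simp: nats_upto_def)
  hence "S_sum \<alpha> ?y = S_sum \<alpha> (real N)" by (simp add: S_sum_def)
  moreover have "main_size ?y \<le> 2 * S_sum \<alpha> ?y"
    using N by (intro S_sum_large[OF X]) auto
  moreover have "S_sum \<alpha> (real N) \<le> 3 / 2 * main_size (real N)"
    by (intro S_sum_large[OF X] N)
  ultimately have *: "main_size ?y \<le> 3 * main_size (real N)" by simp
  have L: "ln (3 * real N) > 0" "ln (3 * ?y) > 0" using N1 lnln_ge[of "real N"] lnln_ge[of ?y] by auto
  have pos: "1 + 1 / (2 * real N) > 0" using N1 by (intro add_pos_nonneg) auto
  have "?y = real N * (1 + 1 / (2 * real N))" using N1 by (simp add: field_simps)
  hence "?y powr \<sigma> = real N powr \<sigma> * (1 + 1 / (2 * real N)) powr \<sigma>"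
    using N1 by (metis powr_mult)
  hence "c * real N powr \<sigma> * ((1 + 1 / (2 * real N)) powr \<sigma> * ln (3 * ?y) powr (\<kappa> - 1))
     \<le> c * real N powr \<sigma> * (3 * ln (3 * real N) powr (\<kappa> - 1))"
    using * unfolding main_size_def by (simp add: mult_ac)
  hence "(1 + 1 / (2 * real N)) powr \<sigma> * ln (3 * ?y) powr (\<kappa> - 1) \<le> 3 * ln (3 * real N) powr (\<kappa> - 1)"
    using c_pos N1 by (subst (asm) mult_le_cancel_left_pos) auto
  hence "(1 + 1 / (2 * real N)) powr \<sigma> \<le> 3 * ln (3 * real N) powr (\<kappa> - 1) / ln (3 * ?y) powr (\<kappa> - 1)"
    using L by (subst pos_le_divide_eq) auto
  also have "\<dots> = 3 * ?D" using L by (simp add: powr_divide)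
  finally have "ln ((1 + 1 / (2 * real N)) powr \<sigma>) \<le> ln (3 * ?D)"
    using N1 L pos by (subst ln_le_cancel_iff) auto
  hence "\<sigma> * ln (1 + 1 / (2 * real N)) \<le> ln (3 * ?D)"
    using pos by (simp add: ln_powr)
  moreover have "ln (1 + 1 / (2 * real N)) > 0" using N1 by (intro ln_gt_zero) auto
  ultimately show ?thesis by (simp add: pos_le_divide_eq)
qed

text \<open>At \<open>N\<close> the comparison of \<open>main_size\<close> with \<open>S_sum\<close>
  turns into an upper bound for \<open>c\<close>. The power \<open>real N powr \<sigma>\<close>
  occurs on both sides and cancels, so the bound \<open>\<sigma>0\<close> is needed only to estimate
  \<open>x powr \<sigma>\<close>.\<close>

lemma main_size_small:
  assumes X: "X \<ge> 1" "K1 / ln (ln (3 * X)) \<le> 1 / 2" and N: "real N \<ge> X"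
    and x: "1 \<le> x" "x \<le> real N" and \<sigma>: "\<sigma> \<le> \<sigma>0"
  shows "main_size x \<le> 2 * real N * (1 + K2) ^ N * real N powr \<sigma>0 * ln (3 * real N) powr (2 * \<bar>\<kappa> - 1\<bar>)"
proof -
  have N1: "real N \<ge> 1" using X N by linarith
  let ?L = "ln (3 * real N)"
  have L: "?L \<ge> 1" using lnln_ge[OF N1] by simp
  have Lx: "ln (3 * x) \<ge> 1" "ln (3 * x) \<le> ?L" using lnln_ge[OF x(1)] x by auto
  have "main_size (real N) \<le> 2 * S_sum \<alpha> (real N)" by (intro S_sum_large[OF X] N)
  also have "\<dots> \<le> 2 * (real N * ((1 + K2) ^ N * real N powr \<sigma>))"
    using N1 by (intro mult_left_mono S_sum_nat_upper) auto
  finally have "real N powr \<sigma> * (c * ?L powr (\<kappa> - 1)) \<le> real N powr \<sigma> * (2 * real N * (1 + K2) ^ N)"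
    by (simp add: main_size_def mult_ac)
  hence 1: "c * ?L powr (\<kappa> - 1) \<le> 2 * real N * (1 + K2) ^ N"
    using N1 by (subst (asm) mult_le_cancel_left_pos) auto
  \<comment> \<open>The exponent \<open>2 * \<bar>\<kappa> - 1\<bar> + (\<kappa> - 1)\<close> is at
    least \<open>\<bar>\<kappa> - 1\<bar>\<close> whatever the sign of \<open>\<kappa> - 1\<close>,
    and it splits off the factor \<open>?L powr (\<kappa> - 1)\<close> that belongs to the bound for
    \<open>c\<close>.\<close>
  have "ln (3 * x) powr (\<kappa> - 1) \<le> ln (3 * x) powr \<bar>\<kappa> - 1\<bar>"
    using Lx by (intro powr_mono) auto
  also have "\<dots> \<le> ?L powr \<bar>\<kappa> - 1\<bar>" using Lx by (intro powr_mono2) auto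
  also have "\<dots> \<le> ?L powr (2 * \<bar>\<kappa> - 1\<bar> + (\<kappa> - 1))" using L by (intro powr_mono) auto
  finally have 2: "ln (3 * x) powr (\<kappa> - 1) \<le> ?L powr (\<kappa> - 1) * ?L powr (2 * \<bar>\<kappa> - 1\<bar>)"
    by (simp add: powr_add mult.commute)
  have "x powr \<sigma> \<le> real N powr \<sigma>" using x \<sigma>_nonneg by (intro powr_mono2) auto
  also have "\<dots> \<le> real N powr \<sigma>0" using N1 \<sigma> by (intro powr_mono) auto
  finally have 3: "x powr \<sigma> \<le> real N powr \<sigma>0" .
  have "main_size x \<le> c * real N powr \<sigma>0 * (?L powr (\<kappa> - 1) * ?L powr (2 * \<bar>\<kappa> - 1\<bar>))"
    unfolding main_size_def using c_pos 2 3 by (intro mult_mono mult_left_mono) auto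
  also have "\<dots> = (c * ?L powr (\<kappa> - 1)) * (real N powr \<sigma>0 * ?L powr (2 * \<bar>\<kappa> - 1\<bar>))"
    by (simp add: mult_ac)
  also have "\<dots> \<le> (2 * real N * (1 + K2) ^ N) * (real N powr \<sigma>0 * ?L powr (2 * \<bar>\<kappa> - 1\<bar>))"
    using 1 by (intro mult_right_mono) auto
  finally show ?thesis by (simp add: mult_ac)
qed

end

text \<open>From \<open>N\<close> on the error term is at most half the main term. Below
  \<open>N\<close> it may swamp the main term; there \<open>S_sum \<alpha> x\<close> is at least
  \<open>\<alpha> 1 = 1\<close>, and \<open>main_size x\<close> is bounded.\<close>

lemma main_size_le_S_sum:
  fixes \<kappa> \<delta> K1 K2 :: real
  shows "\<exists>C>0. \<forall>\<alpha> c \<sigma>. weighted_asymptotics \<alpha> c \<sigma> \<kappa> \<delta> K1 K2 \<longrightarrow>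
    (\<forall>x\<ge>1. weighted_asymptotics.main_size c \<sigma> \<kappa> x \<le> C * S_sum \<alpha> x)"
proof -
  \<comment> \<open>Chosen so that \<open>ln (ln (3 * X))\<close> is at least
    \<open>2 * \<bar>K1\<bar> + 1\<close>. The signs of \<open>K1\<close> and \<open>K2\<close> are
    known only inside the locale, hence the absolute values here and in \<open>C\<close>.\<close>
  define X where "X = exp (exp (2 * \<bar>K1\<bar> + 1))"
  define N where "N = nat \<lceil>X\<rceil>"
  define \<sigma>0 where "\<sigma>0 = ln (3 * (ln (3 * real N) / ln (3 * (real N + 1 / 2))) powr (\<kappa> - 1))
    / ln (1 + 1 / (2 * real N))"
  define C where "C = 2 * real N * (1 + \<bar>K2\<bar>) ^ N * real N powr \<sigma>0 * ln (3 * real N) powr (2 * \<bar>\<kappa> - 1\<bar>)"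
  have X: "X \<ge> 1" by (simp add: X_def)
  have C: "C \<ge> 0" by (simp add: C_def)
  have N: "real N \<ge> X" unfolding N_def using X by linarith
  have "exp (2 * \<bar>K1\<bar> + 1) \<le> ln (3 * X)" using ln_ge_zero[of 3] by (simp add: X_def ln_mult)
  hence "ln (exp (2 * \<bar>K1\<bar> + 1)) \<le> ln (ln (3 * X))"
    by (subst ln_le_cancel_iff) (auto intro: less_le_trans[OF exp_gt_zero])
  hence "2 * K1 \<le> ln (ln (3 * X))" "ln (ln (3 * X)) > 0" by auto
  hence K1: "K1 / ln (ln (3 * X)) \<le> 1 / 2" by (simp add: field_simps)
  have "weighted_asymptotics.main_size c \<sigma> \<kappa> x \<le> (C + 2) * S_sum \<alpha> x"
    if "weighted_asymptotics \<alpha> c \<sigma> \<kappa> \<delta> K1 K2" "x \<ge> 1" for \<alpha> c \<sigma> x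
  proof -
    interpret weighted_asymptotics \<alpha> c \<sigma> \<kappa> \<delta> K1 K2 by (fact that(1))
    have S: "S_sum \<alpha> x \<ge> 1" by (rule S_sum_ge_1[OF that(2)])
    show ?thesis
    proof (cases "x \<ge> real N")
      case True
      hence "main_size x \<le> 2 * S_sum \<alpha> x" using N by (intro S_sum_large[OF X K1]) auto
      thus ?thesis using C S by (simp add: algebra_simps add_increasing)
    next
      case False
      hence "main_size x \<le> C" unfolding C_def
        using main_size_small[OF X K1 N that(2) _ \<sigma>_upper[OF X K1 N]] K2_nonneg
        by (simp add: \<sigma>0_def)
      also have "\<dots> \<le> C * S_sum \<alpha> x" using C S by (simp add: mult_le_cancel_left1)
      finally show ?thesis using S by (simp add: algebra_simps)
    qed
  qed
  thus ?thesis using C by (intro exI[of _ "C + 2"]) auto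
qed

section \<open>Second differences of powers and a weighted Cauchy-Schwarz inequality\<close>

lemma powr_le_two_powr:
  fixes y a :: real
  assumes "1 / 2 \<le> y" "y \<le> 1"
  shows "y powr a \<le> 2 powr \<bar>a\<bar>"
proof -
  have "y powr a \<le> y powr (- \<bar>a\<bar>)" using assms by (intro powr_mono') auto
  also have "\<dots> = (1 / y) powr \<bar>a\<bar>" using assms by (simp add: powr_minus_divide powr_divide)
  also have "\<dots> \<le> 2 powr \<bar>a\<bar>" using assms by (intro powr_mono2) (auto simp: field_simps)
  finally show ?thesis .
qed

text \<open>With h(v) = (1 - v) powr a, the mean value theorem is applied to h(s + v) - h(v) on
  [0, t] and then to the derivative of h on [z, s + z], up to a constant factor. This gives
  \<open>a * (a - 1) * (1 - y) powr (a - 2) * (s * t)\<close> with \<open>y < s + t\<close>. The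
  product \<open>s * t\<close> later turns a double sum into a square.\<close>

lemma powr_second_difference:
  fixes a s t :: real
  assumes "0 \<le> s" "0 \<le> t" "s + t \<le> 1 / 2"
  shows "\<bar>(1 - (s + t)) powr a - (1 - s) powr a - (1 - t) powr a + 1\<bar>
           \<le> \<bar>a\<bar> * \<bar>a - 1\<bar> * 2 powr \<bar>a - 2\<bar> * (s * t)"
proof (cases "s = 0 \<or> t = 0")
  case True
  thus ?thesis by auto
next
  case False
  hence st: "s > 0" "t > 0" using assms by auto
  have deriv: "((\<lambda>v. (1 - v) powr b) has_real_derivative (- b * (1 - v) powr (b - 1))) (at v)"
    if "v < 1" for b v :: real
    using that by (auto intro!: derivative_eq_intros simp: powr_diff field_simps)
  define \<phi> where "\<phi> v = (1 - (s + v)) powr a - (1 - v) powr a" for v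
  define \<phi>' where "\<phi>' v = (- a) * (1 - (s + v)) powr (a - 1) - (- a) * (1 - v) powr (a - 1)" for v
  have "(\<phi> has_real_derivative \<phi>' v) (at v)" if "0 \<le> v" "v \<le> t" for v
    unfolding \<phi>_def \<phi>'_def using assms that
    by (auto intro!: derivative_eq_intros simp: powr_diff field_simps)
  with st obtain z where z: "0 < z" "z < t" "\<phi> t - \<phi> 0 = (t - 0) * \<phi>' z"
    using MVT2[of 0 t \<phi> \<phi>'] by auto
  define \<psi> where "\<psi> v = (1 - v) powr (a - 1)" for v
  have "(\<psi> has_real_derivative (- (a - 1) * (1 - v) powr (a - 2))) (at v)" if "z \<le> v" "v \<le> s + z" for v
    unfolding \<psi>_def using deriv[of v "a - 1"] assms that z by simp
  with st obtain y where y: "z < y" "y < s + z"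
    "\<psi> (s + z) - \<psi> z = (s + z - z) * (- (a - 1) * (1 - y) powr (a - 2))"
    using MVT2[of z "s + z" \<psi> "\<lambda>v. - (a - 1) * (1 - v) powr (a - 2)"] by auto
  have "\<phi>' z = - a * (\<psi> (s + z) - \<psi> z)" by (simp add: \<phi>'_def \<psi>_def algebra_simps)
  also have "\<dots> = a * (a - 1) * (1 - y) powr (a - 2) * s" unfolding y(3) by (simp add: algebra_simps)
  finally have "\<phi> t - \<phi> 0 = a * (a - 1) * (1 - y) powr (a - 2) * (s * t)"
    using z(3) by simp
  moreover have "(1 - y) powr (a - 2) \<le> 2 powr \<bar>a - 2\<bar>"
    using y z assms by (intro powr_le_two_powr) auto
  ultimately have "\<bar>\<phi> t - \<phi> 0\<bar> \<le> \<bar>a\<bar> * \<bar>a - 1\<bar> * 2 powr \<bar>a - 2\<bar> * (s * t)"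
    using st by (simp add: abs_mult mult_left_mono mult_right_mono)
  thus ?thesis by (simp add: \<phi>_def algebra_simps)
qed

lemma weighted_Cauchy_Schwarz:
  fixes w g h :: "'a \<Rightarrow> real"
  assumes "\<And>i. i \<in> A \<Longrightarrow> w i \<ge> 0"
  shows "(\<Sum>i\<in>A. w i * g i * h i)\<^sup>2 \<le> (\<Sum>i\<in>A. w i * (g i)\<^sup>2) * (\<Sum>i\<in>A. w i * (h i)\<^sup>2)"
proof -
  have "(\<Sum>i\<in>A. w i * g i * h i)\<^sup>2 = (\<Sum>i\<in>A. (sqrt (w i) * g i) * (sqrt (w i) * h i))\<^sup>2"
    by (intro arg_cong[where f = "\<lambda>y. y\<^sup>2"] sum.cong refl) (use assms in simp)
  also have "\<dots> \<le> (\<Sum>i\<in>A. (sqrt (w i) * g i)\<^sup>2) * (\<Sum>i\<in>A. (sqrt (w i) * h i)\<^sup>2)"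
    by (rule Cauchy_Schwarz_ineq_sum)
  also have "\<dots> = (\<Sum>i\<in>A. w i * (g i)\<^sup>2) * (\<Sum>i\<in>A. w i * (h i)\<^sup>2)"
    by (intro arg_cong2[where f = "(*)"] sum.cong refl) (use assms in \<open>auto simp: power_mult_distrib\<close>)
  finally show ?thesis .
qed

section \<open>Asymptotics for one and two small prime powers\<close>

context weighted_asymptotics
begin

text \<open>For \<open>d\<close> up to the square root of \<open>x\<close>, replacing
  \<open>x / d\<close> by \<open>x\<close> at most doubles \<open>ln (3 * (x / d))\<close> and so
  adds at most \<open>ln 2\<close> to the iterated logarithm, which is at least
  \<open>ln (ln 3)\<close>.\<close>

definition err_const :: real where
  "err_const = K1 * (1 + ln 2 / ln (ln 3))"

lemma err_const_nonneg: "err_const \<ge> 0"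
  using K1_nonneg lnln3_pos by (simp add: err_const_def)

text \<open>As \<open>d\<close> is at most the square root of \<open>x\<close>, the quotient
  \<open>y = x / d\<close> is at least that root. So \<open>a \<le> x powr (\<delta> / 2)\<close>
  implies \<open>a \<le> y powr \<delta>\<close>, and the hypothesis applies at
  \<open>y\<close>.\<close>

lemma coprime_sum_asymp:
  assumes x: "x \<ge> 1" and d: "1 \<le> d" "d \<le> x powr (1 / 2)"
    and a: "a \<ge> 1" "real a \<le> x powr (\<delta> / 2)" "squarefree a" "card (prime_factors a) \<le> 2"
  obtains E where "\<bar>E\<bar> \<le> err_const / ln (ln (3 * x))"
    "coprime_sum (x / d) a = main_size x * d powr (- \<sigma>) * (1 - ln d / ln (3 * x)) powr (\<kappa> - 1) *
       (inverse (euler_factor a) + E)"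
proof -
  define y where "y = x / d"
  have "x powr (1 / 2) * d \<le> x powr (1 / 2) * x powr (1 / 2)" using d by (intro mult_left_mono) auto
  also have "\<dots> = x" using x by (simp flip: powr_add)
  finally have y: "x powr (1 / 2) \<le> y" using d by (simp add: y_def field_simps)
  have "1 \<le> x powr (1 / 2)" using x by (intro ge_one_powr_ge_zero) auto
  hence y1: "y \<ge> 1" using y by linarith
  have dx: "d \<le> x" using y1 d by (simp add: y_def field_simps)
  have "x = x powr (1 / 2) * x powr (1 / 2)" using x by (simp flip: powr_add)
  also have "\<dots> \<le> y * y" using y y1 by (intro mult_mono) auto
  finally have xy: "3 * x \<le> (3 * y) * (3 * y)" using x by simp
  have "real a \<le> (x powr (1 / 2)) powr \<delta>" using a by (simp add: powr_powr)
  also have "\<dots> \<le> y powr \<delta>" using y \<delta>_pos by (intro powr_mono2) auto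
  finally obtain E where E: "\<bar>E\<bar> \<le> K1 * (1 / ln (ln (3 * y)))"
    "coprime_sum y a = main_size y * (inverse (euler_factor a) + E)"
    using asymp[OF y1 a(1) _ a(3,4)] by (auto simp: coprime_sum_def main_size_def)
  note Lx = lnln_ge[OF x] and Ly = lnln_ge[OF y1]
  have "ln (3 * x) \<le> ln ((3 * y) * (3 * y))" using xy x y1 by (subst ln_le_cancel_iff) auto
  also have "\<dots> = 2 * ln (3 * y)" using y1 by (subst ln_mult) auto
  finally have "ln (ln (3 * x)) \<le> ln (2 * ln (3 * y))" using Lx Ly by (subst ln_le_cancel_iff) auto
  also have "\<dots> = ln 2 + ln (ln (3 * y))" using Ly by (subst ln_mult) auto
  also have "ln 2 \<le> ln 2 / ln (ln 3) * ln (ln (3 * y))"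
    using Ly lnln3_pos by (simp add: field_simps)
  finally have "ln (ln (3 * x)) \<le> (1 + ln 2 / ln (ln 3)) * ln (ln (3 * y))" by (simp add: algebra_simps)
  hence "K1 * ln (ln (3 * x)) \<le> err_const * ln (ln (3 * y))"
    using K1_nonneg unfolding err_const_def by (metis mult.assoc mult_left_mono)
  hence "K1 / ln (ln (3 * y)) \<le> err_const / ln (ln (3 * x))"
    using Lx Ly by (auto intro!: mult_imp_le_div_pos mult_imp_div_pos_le)
  hence "\<bar>E\<bar> \<le> err_const / ln (ln (3 * x))" using E(1) by simp
  moreover have "coprime_sum (x / d) a = main_size x * d powr (- \<sigma>) * (1 - ln d / ln (3 * x)) powr (\<kappa> - 1) *
       (inverse (euler_factor a) + E)"
    using E(2) main_size_divide[OF d(1) dx] by (simp add: y_def)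
  ultimately show ?thesis by (rule that)
qed

text \<open>The fourths make the product of two small prime powers at most
  \<open>x powr (1 / 2)\<close> and the product of their primes at most
  \<open>x powr (\<delta> / 2)\<close>, as \<open>coprime_sum_asymp\<close> requires.\<close>

definition cut_exp :: real where "cut_exp = min (1 / 4) (\<delta> / 4)"

lemma cut_exp_bounds: "cut_exp > 0" "cut_exp \<le> 1 / 4" "cut_exp \<le> \<delta> / 4"
  using \<delta>_pos by (auto simp: cut_exp_def)

text \<open>The predicted density of exact divisibility by \<open>q\<close>: the weight of
  \<open>q\<close> times the density factor for a cofactor prime to \<open>fst q\<close>.
  \<open>A_mean\<close> is the sum of \<open>f\<close> over prime powers against it.\<close>

definition pp_mean :: "nat \<times> nat \<Rightarrow> real" where
  "pp_mean q = pp_weight q * inverse (euler_factor (fst q))"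

lemma pp_mean_bounds:
  assumes "prime (fst q)"
  shows "0 \<le> pp_mean q" "pp_mean q \<le> pp_weight q"
  using pp_weight_nonneg[OF assms] inverse_euler_factor_bounds[OF assms]
  by (auto simp: pp_mean_def intro: mult_left_le)

definition pp_ratio :: "real \<Rightarrow> nat \<times> nat \<Rightarrow> real" where
  "pp_ratio x q = ln (pp_val q) / ln (3 * x)"

lemma pp_ratio_bounds:
  assumes "q \<in> prime_powers_upto x"
  shows "0 \<le> pp_ratio x q" "pp_ratio x q < 1"
proof -
  note D = prime_powers_uptoD[OF assms]
  have L: "ln (3 * x) > 0" using D(5) lnln_ge[of x] by simp
  have "ln (pp_val q) < ln (3 * x)"
    using D(3,4,5) by (subst ln_less_cancel_iff) linarith+
  thus "pp_ratio x q < 1" using L by (simp add: pp_ratio_def)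
  show "0 \<le> pp_ratio x q" using D L unfolding pp_ratio_def by (intro divide_nonneg_pos ln_ge_zero) auto
qed

lemma small_pp:
  assumes x: "x \<ge> 1" and q: "q \<in> prime_powers_upto (x powr cut_exp)"
  shows "q \<in> prime_powers_upto x" "pp_val q \<le> x powr (1 / 4)" "real (fst q) \<le> x powr (\<delta> / 4)"
    "pp_ratio x q \<le> 1 / 4"
proof -
  note D = prime_powers_uptoD[OF q]
  have "x powr cut_exp \<le> x powr 1" using x cut_exp_bounds by (intro powr_mono) auto
  thus "q \<in> prime_powers_upto x" using q x prime_powers_upto_mono[of "x powr cut_exp" x] by auto
  have "x powr cut_exp \<le> x powr (1 / 4)" using x cut_exp_bounds by (intro powr_mono) auto
  thus v: "pp_val q \<le> x powr (1 / 4)" using D by linarith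
  have "x powr cut_exp \<le> x powr (\<delta> / 4)" using x cut_exp_bounds by (intro powr_mono) auto
  thus "real (fst q) \<le> x powr (\<delta> / 4)" using D by linarith
  have "ln (pp_val q) \<le> ln (x powr (1 / 4))" using v D(4) x by (subst ln_le_cancel_iff) (linarith, simp, assumption)
  also have "\<dots> \<le> 1 / 4 * ln (3 * x)" using x by (simp add: ln_powr)
  finally show "pp_ratio x q \<le> 1 / 4" using lnln_ge[OF x] by (simp add: pp_ratio_def field_simps)
qed

lemma sum_small_exact_power:
  assumes x: "x \<ge> 1" and q: "q \<in> prime_powers_upto (x powr cut_exp)"
  obtains E where "\<bar>E\<bar> \<le> err_const / ln (ln (3 * x))"
    "(\<Sum>n\<in>nats_upto x. \<alpha> n * of_bool (q \<in> exact_powers n)) =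
       main_size x * (pp_weight q * ((1 - pp_ratio x q) powr (\<kappa> - 1) * (inverse (euler_factor (fst q)) + E)))"
proof -
  note D = prime_powers_uptoD[OF q] and sm = small_pp[OF x q]
  have "x powr (1 / 4) \<le> x powr (1 / 2)" using x by (intro powr_mono) auto
  hence d: "pp_val q \<le> x powr (1 / 2)" using sm by linarith
  have "x powr (\<delta> / 4) \<le> x powr (\<delta> / 2)" using x \<delta>_pos by (intro powr_mono) auto
  hence a: "real (fst q) \<le> x powr (\<delta> / 2)" using sm by linarith
  have d1: "1 \<le> pp_val q" using D by linarith
  have a': "1 \<le> fst q" "squarefree (fst q)" "card (prime_factors (fst q)) \<le> 2"
    using D(1) by (auto simp: Suc_le_eq prime_gt_0_nat squarefree_prime prime_factorization_prime)
  obtain E where E: "\<bar>E\<bar> \<le> err_const / ln (ln (3 * x))"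
    "coprime_sum (x / pp_val q) (fst q) = main_size x * pp_val q powr (- \<sigma>) *
       (1 - ln (pp_val q) / ln (3 * x)) powr (\<kappa> - 1) * (inverse (euler_factor (fst q)) + E)"
    using coprime_sum_asymp[OF x d1 d a'(1) a a'(2,3)] .
  have "(\<Sum>n\<in>nats_upto x. \<alpha> n * of_bool (q \<in> exact_powers n))
      = \<alpha> (fst q ^ snd q) * coprime_sum (x / pp_val q) (fst q)"
    using sum_exact_power[OF mult D(1,2), of x] by (simp add: coprime_sum_def)
  also have "\<dots> = main_size x * ((\<alpha> (fst q ^ snd q) * pp_val q powr (- \<sigma>)) *
     ((1 - pp_ratio x q) powr (\<kappa> - 1) * (inverse (euler_factor (fst q)) + E)))"
    unfolding E(2) pp_ratio_def by (simp only: mult_ac)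
  finally show ?thesis using E(1) that D(1) by (simp only: pp_weight_alt)
qed

lemma sum_two_small_exact_powers:
  assumes x: "x \<ge> 1" and q: "q \<in> prime_powers_upto (x powr cut_exp)"
    and r: "r \<in> prime_powers_upto (x powr cut_exp)" and neq: "fst q \<noteq> fst r"
  obtains E where "\<bar>E\<bar> \<le> err_const / ln (ln (3 * x))"
    "(\<Sum>n\<in>nats_upto x. \<alpha> n * of_bool (q \<in> exact_powers n \<and> r \<in> exact_powers n)) =
       main_size x * (pp_weight q * pp_weight r * ((1 - (pp_ratio x q + pp_ratio x r)) powr (\<kappa> - 1) *
         (inverse (euler_factor (fst q)) * inverse (euler_factor (fst r)) + E)))"
proof -
  note D = prime_powers_uptoD[OF q] and sm = small_pp[OF x q]
  note D' = prime_powers_uptoD[OF r] and sm' = small_pp[OF x r]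
  have "pp_val q * pp_val r \<le> x powr (1 / 4) * x powr (1 / 4)"
    using sm sm' by (intro mult_mono) auto
  hence d: "pp_val q * pp_val r \<le> x powr (1 / 2)" using x by (simp flip: powr_add)
  have d1: "1 \<le> pp_val q * pp_val r" using D(4) D'(4) mult_mono[of 1 "pp_val q" 1 "pp_val r"] by auto
  have "real (fst q) * real (fst r) \<le> x powr (\<delta> / 4) * x powr (\<delta> / 4)"
    using sm sm' by (intro mult_mono) auto
  hence a: "real (fst q * fst r) \<le> x powr (\<delta> / 2)" using x by (simp flip: powr_add)
  have cop: "coprime (fst q) (fst r)" using D(1) D'(1) neq by (rule primes_coprime)
  have pos: "fst q > 0" "fst r > 0" using D(1) D'(1) by (auto simp: prime_gt_0_nat)
  have a1: "1 \<le> fst q * fst r" using pos by (simp add: Suc_le_eq)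
  have a2: "squarefree (fst q * fst r)"
    using D(1) D'(1) cop by (intro squarefree_mult_coprime squarefree_prime) auto
  have a3: "card (prime_factors (fst q * fst r)) \<le> 2"
    using D(1) D'(1) pos by (simp add: prime_factors_product prime_factorization_prime card_insert_if)
  obtain E where E: "\<bar>E\<bar> \<le> err_const / ln (ln (3 * x))"
    "coprime_sum (x / (pp_val q * pp_val r)) (fst q * fst r) = main_size x * (pp_val q * pp_val r) powr (- \<sigma>) *
       (1 - ln (pp_val q * pp_val r) / ln (3 * x)) powr (\<kappa> - 1) * (inverse (euler_factor (fst q * fst r)) + E)"
    using coprime_sum_asymp[OF x d1 d a1 a a2 a3] .
  have ln: "ln (pp_val q * pp_val r) / ln (3 * x) = pp_ratio x q + pp_ratio x r"
    using pos by (simp add: pp_ratio_def ln_mult add_divide_distrib)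
  have pw: "(pp_val q * pp_val r) powr (- \<sigma>) = pp_val q powr (- \<sigma>) * pp_val r powr (- \<sigma>)"
    by (rule powr_mult)
  have F: "inverse (euler_factor (fst q * fst r)) = inverse (euler_factor (fst q)) * inverse (euler_factor (fst r))"
    using D(1) D'(1) neq by (simp add: euler_factor_mult)
  have "(\<Sum>n\<in>nats_upto x. \<alpha> n * of_bool (q \<in> exact_powers n \<and> r \<in> exact_powers n))
      = \<alpha> (fst q ^ snd q) * \<alpha> (fst r ^ snd r) * coprime_sum (x / (pp_val q * pp_val r)) (fst q * fst r)"
    using sum_two_exact_powers[OF mult D(1,2) D'(1,2) neq, of x] by (simp add: coprime_sum_def)
  also have "\<dots> = main_size x * ((\<alpha> (fst q ^ snd q) * pp_val q powr (- \<sigma>)) * (\<alpha> (fst r ^ snd r) * pp_val r powr (- \<sigma>)) *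
     ((1 - (pp_ratio x q + pp_ratio x r)) powr (\<kappa> - 1) *
     (inverse (euler_factor (fst q)) * inverse (euler_factor (fst r)) + E)))"
    unfolding E(2) ln pw F by (simp only: mult_ac)
  finally show ?thesis using E(1) that D(1) D'(1) by (simp only: pp_weight_alt)
qed

definition upper_const :: real where
  "upper_const = 1 + K1 / ln (ln 3)"

definition shift_const :: real where
  "shift_const = 2 powr \<bar>\<kappa> - 1\<bar>"

text \<open>The constant of \<open>powr_second_difference\<close> at
  \<open>a = \<kappa> - 1\<close>, hence \<open>\<kappa> - 1 - 1\<close> and
  \<open>\<kappa> - 1 - 2\<close>.\<close>

definition diff_const :: real where
  "diff_const = \<bar>\<kappa> - 1\<bar> * \<bar>\<kappa> - 1 - 1\<bar> * 2 powr \<bar>\<kappa> - 1 - 2\<bar>"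

lemma shared_const_bounds: "upper_const \<ge> 1" "shift_const \<ge> 1" "diff_const \<ge> 0"
  using K1_nonneg lnln3_pos
  by (auto simp: upper_const_def shift_const_def diff_const_def intro: ge_one_powr_ge_zero)

section \<open>Covariances of exact divisibility\<close>

definition exact_sum :: "real \<Rightarrow> nat \<times> nat \<Rightarrow> real" where
  "exact_sum x q = (\<Sum>n\<in>nats_upto x. \<alpha> n * of_bool (q \<in> exact_powers n))"

definition joint_sum :: "real \<Rightarrow> nat \<times> nat \<Rightarrow> nat \<times> nat \<Rightarrow> real" where
  "joint_sum x q r = (\<Sum>n\<in>nats_upto x. \<alpha> n * of_bool (q \<in> exact_powers n \<and> r \<in> exact_powers n))"

text \<open>Centred at the predicted density \<open>pp_mean\<close> rather than at the true average,
  because \<open>A_mean\<close> is built from the former, and not normalized by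
  \<open>S_sum \<alpha> x\<close>.\<close>

definition covar :: "real \<Rightarrow> nat \<times> nat \<Rightarrow> nat \<times> nat \<Rightarrow> real" where
  "covar x q r = (\<Sum>n\<in>nats_upto x. \<alpha> n *
     ((of_bool (q \<in> exact_powers n) - pp_mean q) * (of_bool (r \<in> exact_powers n) - pp_mean r)))"

lemma covar_expand:
  "covar x q r = joint_sum x q r - pp_mean q * exact_sum x r - pp_mean r * exact_sum x q
     + pp_mean q * pp_mean r * S_sum \<alpha> x"
proof -
  have "covar x q r = (\<Sum>n\<in>nats_upto x. \<alpha> n * of_bool (q \<in> exact_powers n \<and> r \<in> exact_powers n)
      - pp_mean q * (\<alpha> n * of_bool (r \<in> exact_powers n)) - pp_mean r * (\<alpha> n * of_bool (q \<in> exact_powers n))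
      + pp_mean q * pp_mean r * \<alpha> n)"
    unfolding covar_def by (intro sum.cong refl) (auto simp: algebra_simps)
  thus ?thesis
    by (simp add: joint_sum_def exact_sum_def S_sum_def sum.distrib sum_subtractf sum_distrib_left)
qed

lemma exact_sum_nonneg: "exact_sum x q \<ge> 0"
  unfolding exact_sum_def by (intro sum_nonneg mult_nonneg_nonneg nonneg) (auto simp: nats_upto_def)

lemma exact_sum_small_upper:
  assumes x: "x \<ge> 1" and q: "q \<in> prime_powers_upto (x powr cut_exp)"
  shows "exact_sum x q \<le> upper_const * shift_const * main_size x * pp_weight q"
proof -
  note sm = small_pp[OF x q] and D = prime_powers_uptoD[OF q]
  note b = pp_ratio_bounds[OF sm(1)]
  have "exact_sum x q \<le> upper_const * main_size x * (pp_weight q * (1 - pp_ratio x q) powr (\<kappa> - 1))"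
    using sum_exact_power_upper[OF sm(1)] by (simp add: exact_sum_def upper_const_def pp_ratio_def)
  also have "\<dots> \<le> upper_const * main_size x * (pp_weight q * shift_const)"
    unfolding shift_const_def
    using sm b main_size_pos[OF x] shared_const_bounds pp_weight_nonneg[OF D(1)]
    by (intro mult_left_mono powr_le_two_powr) auto
  finally show ?thesis by (simp add: mult_ac)
qed

text \<open>Without cancellation: the joint sum vanishes for \<open>q \<noteq> r\<close>, and the
  other three terms of \<open>covar_expand\<close> are bounded one by one, hence the 3. Each keeps
  one factor \<open>inverse (euler_factor (fst q))\<close>, which the summation over powers of one
  prime needs.\<close>

lemma covar_same_prime:
  assumes x: "x \<ge> 1" and q: "q \<in> prime_powers_upto (x powr cut_exp)"
    and r: "r \<in> prime_powers_upto (x powr cut_exp)" and eq: "fst q = fst r"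
  shows "\<bar>covar x q r\<bar> \<le> upper_const * shift_const * main_size x *
     (of_bool (q = r) * pp_weight q + 3 * (pp_weight q * pp_weight r * inverse (euler_factor (fst q))))"
proof -
  let ?U = "upper_const * shift_const * main_size x" and ?f = "inverse (euler_factor (fst q))"
  note D = prime_powers_uptoD[OF q] and D' = prime_powers_uptoD[OF r]
  have w: "pp_weight q \<ge> 0" "pp_weight r \<ge> 0" using D(1) D'(1) by (auto intro: pp_weight_nonneg)
  have f: "?f \<ge> 0" "?f \<le> 1" using inverse_euler_factor_bounds[OF D(1)] by auto
  have M: "main_size x > 0" by (rule main_size_pos[OF x])
  have v: "pp_mean q = pp_weight q * ?f" "pp_mean r = pp_weight r * ?f"
    using eq by (auto simp: pp_mean_def)
  note vb = pp_mean_bounds[OF D(1)] pp_mean_bounds[OF D'(1)]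
  have J: "0 \<le> joint_sum x q r \<and> joint_sum x q r \<le> ?U * (of_bool (q = r) * pp_weight q)"
  proof (cases "q = r")
    case True
    hence "joint_sum x q r = exact_sum x q" by (simp add: joint_sum_def exact_sum_def)
    thus ?thesis using True exact_sum_small_upper[OF x q] exact_sum_nonneg by simp
  next
    case False
    hence "\<not> (q \<in> exact_powers n \<and> r \<in> exact_powers n)" for n
      using eq by (cases q; cases r) (auto simp: mem_exact_powers_iff)
    hence "joint_sum x q r = 0" unfolding joint_sum_def by (intro sum.neutral) auto
    thus ?thesis using False by simp
  qed
  have 1: "pp_mean q * exact_sum x r \<le> ?U * (pp_weight q * pp_weight r * ?f)"
    using mult_left_mono[OF exact_sum_small_upper[OF x r] vb(1)] by (simp add: v mult_ac)
  have 2: "pp_mean r * exact_sum x q \<le> ?U * (pp_weight q * pp_weight r * ?f)"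
    using mult_left_mono[OF exact_sum_small_upper[OF x q] vb(3)] by (simp add: v mult_ac)
  have "pp_mean q * pp_mean r * S_sum \<alpha> x \<le> (pp_weight q * pp_weight r * ?f) * ?U"
  proof (rule mult_mono)
    show "pp_mean q * pp_mean r \<le> pp_weight q * pp_weight r * ?f"
      using vb w mult_left_mono[OF vb(2), of "pp_mean r"] by (simp add: v mult_ac)
    have "S_sum \<alpha> x \<le> upper_const * main_size x"
      using S_sum_upper[OF x] by (simp add: upper_const_def)
    also have "\<dots> \<le> shift_const * (upper_const * main_size x)"
      using shared_const_bounds M mult_right_mono[of 1 shift_const "upper_const * main_size x"] by simp
    finally show "S_sum \<alpha> x \<le> ?U" by (simp add: mult_ac)
  qed (use w f coprime_sum_bounds[of x 1] in \<open>auto simp: S_sum_eq\<close>)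
  hence 3: "pp_mean q * pp_mean r * S_sum \<alpha> x \<le> ?U * (pp_weight q * pp_weight r * ?f)"
    by (simp add: mult.commute)
  have nn: "0 \<le> pp_mean q * exact_sum x r" "0 \<le> pp_mean r * exact_sum x q"
    "0 \<le> pp_mean q * pp_mean r * S_sum \<alpha> x"
    using vb exact_sum_nonneg S_sum_ge_1[OF x] by (auto intro!: mult_nonneg_nonneg)
  have "\<bar>covar x q r\<bar> \<le> ?U * (of_bool (q = r) * pp_weight q) + 3 * (?U * (pp_weight q * pp_weight r * ?f))"
    unfolding covar_expand using J 1 2 3 nn by linarith
  thus ?thesis by (simp add: distrib_left mult.left_commute)
qed

text \<open>The main parts of the four terms of \<open>covar_expand\<close> share the two weights
  and both inverse Euler factors; what remains is \<open>h3 - h1 - h2 + 1\<close>, a second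
  difference with 1 = h(0). The four error terms cost \<open>shift_const * e\<close> each.\<close>

lemma covar_distinct_primes:
  assumes x: "x \<ge> 1" and q: "q \<in> prime_powers_upto (x powr cut_exp)"
    and r: "r \<in> prime_powers_upto (x powr cut_exp)" and neq: "fst q \<noteq> fst r"
  shows "\<bar>covar x q r\<bar> \<le> main_size x * (pp_weight q * pp_weight r *
     (diff_const * (pp_ratio x q * pp_ratio x r) + 4 * shift_const * err_const / ln (ln (3 * x))))"
proof -
  note D = prime_powers_uptoD[OF q] and D' = prime_powers_uptoD[OF r]
  note sm = small_pp[OF x q] and sm' = small_pp[OF x r]
  note b = pp_ratio_bounds[OF sm(1)] and b' = pp_ratio_bounds[OF sm'(1)]
  define s t f g where "s = pp_ratio x q" and "t = pp_ratio x r"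
    and "f = inverse (euler_factor (fst q))" and "g = inverse (euler_factor (fst r))"
  define e where "e = err_const / ln (ln (3 * x))"
  have e: "e \<ge> 0" unfolding e_def using err_const_nonneg lnln_ge[OF x] by simp
  have st: "0 \<le> s" "0 \<le> t" "s \<le> 1 / 4" "t \<le> 1 / 4" using b b' sm sm' by (auto simp: s_def t_def)
  have fg: "0 \<le> f" "f \<le> 1" "0 \<le> g" "g \<le> 1"
    using inverse_euler_factor_bounds[OF D(1)] inverse_euler_factor_bounds[OF D'(1)]
    by (auto simp: f_def g_def)
  have w: "pp_weight q \<ge> 0" "pp_weight r \<ge> 0" using D(1) D'(1) by (auto intro: pp_weight_nonneg)
  obtain E0 where E0: "\<bar>E0\<bar> \<le> K1 / ln (ln (3 * x))" "S_sum \<alpha> x = main_size x * (1 + E0)"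
    using S_sum_asymp[OF x] .
  obtain E1 where E1: "\<bar>E1\<bar> \<le> e"
    "exact_sum x q = main_size x * (pp_weight q * ((1 - s) powr (\<kappa> - 1) * (f + E1)))"
    unfolding e_def s_def f_def exact_sum_def using sum_small_exact_power[OF x q] .
  obtain E2 where E2: "\<bar>E2\<bar> \<le> e"
    "exact_sum x r = main_size x * (pp_weight r * ((1 - t) powr (\<kappa> - 1) * (g + E2)))"
    unfolding e_def t_def g_def exact_sum_def using sum_small_exact_power[OF x r] .
  obtain E3 where E3: "\<bar>E3\<bar> \<le> e"
    "joint_sum x q r = main_size x * (pp_weight q * pp_weight r * ((1 - (s + t)) powr (\<kappa> - 1) * (f * g + E3)))"
    unfolding e_def s_def t_def f_def g_def joint_sum_def using sum_two_small_exact_powers[OF x q r neq] .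
  \<comment> \<open>The formula for \<open>S_sum \<alpha> x\<close> itself carries
    \<open>K1\<close>; enlarging it gives all four errors the common bound \<open>e\<close>.\<close>
  have "K1 \<le> err_const" unfolding err_const_def
    using K1_nonneg lnln3_pos mult_left_mono[of 1 "1 + ln 2 / ln (ln 3)" K1] by simp
  hence "K1 / ln (ln (3 * x)) \<le> e"
    unfolding e_def using lnln_ge[OF x] by (intro divide_right_mono) auto
  hence E0': "\<bar>E0\<bar> \<le> e" using E0 by linarith
  define h1 h2 h3 where "h1 = (1 - s) powr (\<kappa> - 1)" and "h2 = (1 - t) powr (\<kappa> - 1)"
    and "h3 = (1 - (s + t)) powr (\<kappa> - 1)"
  have h: "\<bar>h1\<bar> \<le> shift_const" "\<bar>h2\<bar> \<le> shift_const" "\<bar>h3\<bar> \<le> shift_const"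
    using st by (auto simp: h1_def h2_def h3_def shift_const_def intro!: powr_le_two_powr)
  have "covar x q r = main_size x * (pp_weight q * pp_weight r *
     (f * g * (h3 - h1 - h2 + 1) + (h3 * E3 - g * (h1 * E1) - f * (h2 * E2) + f * g * E0)))"
    unfolding covar_expand E0(2) E1(2) E2(2) E3(2) pp_mean_def f_def[symmetric] g_def[symmetric]
      h1_def[symmetric] h2_def[symmetric] h3_def[symmetric]
    by (simp add: algebra_simps)
  moreover have "\<bar>f * g * (h3 - h1 - h2 + 1)\<bar> \<le> 1 * (diff_const * (s * t))"
    unfolding abs_mult[of "f * g"]
  proof (intro mult_mono)
    show "\<bar>h3 - h1 - h2 + 1\<bar> \<le> diff_const * (s * t)"
      unfolding h1_def h2_def h3_def diff_const_def using st by (intro powr_second_difference) auto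
    show "\<bar>f * g\<bar> \<le> 1" using fg by (auto simp: abs_mult intro: mult_le_one)
  qed auto
  moreover have "\<bar>h3 * E3\<bar> \<le> shift_const * e"
    unfolding abs_mult using h E3 shared_const_bounds by (intro mult_mono) auto
  moreover have "\<bar>g * (h1 * E1)\<bar> \<le> 1 * (shift_const * e)"
    unfolding abs_mult using h E1 shared_const_bounds fg e by (intro mult_mono) auto
  moreover have "\<bar>f * (h2 * E2)\<bar> \<le> 1 * (shift_const * e)"
    unfolding abs_mult using h E2 shared_const_bounds fg e by (intro mult_mono) auto
  moreover have "\<bar>f * g * E0\<bar> \<le> shift_const * e"
  proof -
    have "f * g \<le> 1" using fg by (intro mult_le_one) auto
    thus ?thesis unfolding abs_mult[of "f * g"] using E0' shared_const_bounds fg e by (intro mult_mono) auto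
  qed
  ultimately have "\<bar>covar x q r\<bar> = main_size x * (pp_weight q * pp_weight r *
     \<bar>f * g * (h3 - h1 - h2 + 1) + (h3 * E3 - g * (h1 * E1) - f * (h2 * E2) + f * g * E0)\<bar>)"
    and "\<bar>f * g * (h3 - h1 - h2 + 1) + (h3 * E3 - g * (h1 * E1) - f * (h2 * E2) + f * g * E0)\<bar>
      \<le> diff_const * (s * t) + 4 * (shift_const * e)"
    using w main_size_pos[OF x] by (simp add: abs_mult, linarith)
  moreover have "0 \<le> main_size x" "0 \<le> pp_weight q * pp_weight r"
    using main_size_pos[OF x] w by auto
  ultimately have "\<bar>covar x q r\<bar> \<le> main_size x * (pp_weight q * pp_weight r *
      (diff_const * (s * t) + 4 * (shift_const * e)))"
    by (metis mult_left_mono)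
  thus ?thesis by (simp add: s_def t_def e_def mult.assoc)
qed

text \<open>The indicators merge both cases into one bound, so that the double sum over all pairs
  splits into four sums that can be treated separately.\<close>

lemma covar_upper:
  assumes x: "x \<ge> 1" and q: "q \<in> prime_powers_upto (x powr cut_exp)"
    and r: "r \<in> prime_powers_upto (x powr cut_exp)"
  shows "\<bar>covar x q r\<bar> \<le> main_size x *
     (diff_const * ((pp_weight q * pp_ratio x q) * (pp_weight r * pp_ratio x r))
      + 4 * shift_const * err_const / ln (ln (3 * x)) * (pp_weight q * pp_weight r)
      + upper_const * shift_const * (of_bool (q = r) * pp_weight q)
      + 3 * upper_const * shift_const *
         (of_bool (fst q = fst r) * (pp_weight q * pp_weight r * inverse (euler_factor (fst q)))))"
proof -
  note D = prime_powers_uptoD[OF q] and D' = prime_powers_uptoD[OF r]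
  note b = pp_ratio_bounds[OF small_pp(1)[OF x q]] and b' = pp_ratio_bounds[OF small_pp(1)[OF x r]]
  have w: "pp_weight q \<ge> 0" "pp_weight r \<ge> 0" using D(1) D'(1) by (auto intro: pp_weight_nonneg)
  have f: "inverse (euler_factor (fst q)) \<ge> 0" using inverse_euler_factor_bounds[OF D(1)] by auto
  have M: "main_size x > 0" by (rule main_size_pos[OF x])
  have L: "ln (ln (3 * x)) > 0" using lnln_ge[OF x] by simp
  show ?thesis
  proof (cases "fst q = fst r")
    case True
    have "\<bar>covar x q r\<bar> \<le> main_size x * (upper_const * shift_const * (of_bool (q = r) * pp_weight q)
      + 3 * upper_const * shift_const *
         (of_bool (fst q = fst r) * (pp_weight q * pp_weight r * inverse (euler_factor (fst q)))))"
      using covar_same_prime[OF x q r True] True by (simp add: algebra_simps)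
    also have "\<dots> \<le> main_size x *
     (diff_const * ((pp_weight q * pp_ratio x q) * (pp_weight r * pp_ratio x r))
      + 4 * shift_const * err_const / ln (ln (3 * x)) * (pp_weight q * pp_weight r)
      + upper_const * shift_const * (of_bool (q = r) * pp_weight q)
      + 3 * upper_const * shift_const *
         (of_bool (fst q = fst r) * (pp_weight q * pp_weight r * inverse (euler_factor (fst q)))))"
    proof -
      have "0 \<le> diff_const * ((pp_weight q * pp_ratio x q) * (pp_weight r * pp_ratio x r))"
        using shared_const_bounds w b b' by (intro mult_nonneg_nonneg) auto
      moreover have "0 \<le> 4 * shift_const * err_const / ln (ln (3 * x)) * (pp_weight q * pp_weight r)"
        using shared_const_bounds err_const_nonneg w L by (intro mult_nonneg_nonneg divide_nonneg_nonneg) auto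
      ultimately show ?thesis using M by (intro mult_left_mono) auto
    qed
    finally show ?thesis .
  next
    case False
    hence "q \<noteq> r" by auto
    thus ?thesis using covar_distinct_primes[OF x q r False] False
      by (simp add: algebra_simps)
  qed
qed

section \<open>Variance over the small prime powers\<close>

text \<open>One summand for each term of \<open>covar_upper\<close>, with the 1 and 3 of the last
  two merged into 4. In the second, \<open>loglog_const\<close> is what remains after
  \<open>ln (ln (3 * x))\<close> has cancelled.\<close>

definition small_const :: real where
  "small_const = diff_const * K2 + 4 * shift_const * err_const * loglog_const + 4 * upper_const * shift_const"

lemma sum_pp_weight_ratio_upper:
  assumes "x \<ge> 1"
  shows "(\<Sum>q\<in>prime_powers_upto x. pp_weight q * pp_ratio x q) \<le> K2"
proof (cases "x \<ge> 2")
  case False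
  hence "prime_powers_upto x = {}" using prime_powers_uptoD(5) by blast
  thus ?thesis using K2_nonneg by simp
next
  case x: True
  have L: "ln (3 * x) > 0" using lnln_ge[OF assms] by simp
  have "(\<Sum>q\<in>prime_powers_upto x. pp_weight q * pp_ratio x q)
      = (\<Sum>q\<in>prime_powers_upto x. pp_weight q * ln (pp_val q)) / ln (3 * x)"
    unfolding pp_ratio_def sum_divide_distrib by simp
  also have "\<dots> \<le> K2 * ln x / ln (3 * x)"
    using sum_pp_weight_ln[OF x] L by (intro divide_right_mono) auto
  also have "\<dots> \<le> K2"
  proof -
    have "ln x \<le> ln (3 * x)" using x by simp
    thus ?thesis using L K2_nonneg by (simp add: pos_divide_le_eq mult_left_mono)
  qed
  finally show ?thesis .
qed

text \<open>The coefficients \<open>b\<close> are arbitrary reals, so that the real and the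
  imaginary part of \<open>f\<close> can be inserted later.\<close>

lemma small_variance:
  assumes x: "x \<ge> 1"
  defines "Q \<equiv> prime_powers_upto (x powr cut_exp)"
  shows "(\<Sum>n\<in>nats_upto x. \<alpha> n * (\<Sum>q\<in>Q. b q * (of_bool (q \<in> exact_powers n) - pp_mean q))\<^sup>2)
    \<le> small_const * main_size x * (\<Sum>q\<in>Q. pp_weight q * (b q)\<^sup>2)"
proof -
  let ?B = "\<Sum>q\<in>Q. pp_weight q * (b q)\<^sup>2"
  let ?w = pp_weight and ?u = "pp_ratio x" and ?l = "ln (ln (3 * x))"
  have finQ: "finite Q" by (simp add: Q_def finite_prime_powers_upto)
  have QP: "Q \<subseteq> prime_powers_upto x" unfolding Q_def using small_pp(1)[OF x] by blast
  have w: "?w q \<ge> 0" "prime (fst q)" "0 \<le> ?u q" "?u q \<le> 1" "1 \<le> snd q" if "q \<in> Q" for q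
    using that QP pp_ratio_bounds[of q x] prime_powers_uptoD(1,2)[of q x]
    by (auto intro!: pp_weight_nonneg intro: less_imp_le[of _ 1])
  have l: "?l > 0" using lnln_ge[OF x] by simp
  have M: "main_size x > 0" by (rule main_size_pos[OF x])
  have B: "?B \<ge> 0" using w by (intro sum_nonneg mult_nonneg_nonneg) auto

  have "(\<Sum>n\<in>nats_upto x. \<alpha> n * (\<Sum>q\<in>Q. b q * (of_bool (q \<in> exact_powers n) - pp_mean q))\<^sup>2)
      = (\<Sum>n\<in>nats_upto x. \<Sum>q\<in>Q. \<Sum>r\<in>Q. b q * b r * (\<alpha> n *
         ((of_bool (q \<in> exact_powers n) - pp_mean q) * (of_bool (r \<in> exact_powers n) - pp_mean r))))"
    by (simp only: power2_eq_square sum_product sum_distrib_left mult_ac)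
  also have "\<dots> = (\<Sum>q\<in>Q. \<Sum>r\<in>Q. b q * b r * covar x q r)"
    unfolding covar_def sum_distrib_left
    by (subst sum.swap, rule sum.cong[OF refl], rule sum.swap)
  also have "\<dots> \<le> (\<Sum>q\<in>Q. \<Sum>r\<in>Q. \<bar>b q\<bar> * \<bar>b r\<bar> * (main_size x *
     (diff_const * ((?w q * ?u q) * (?w r * ?u r))
      + 4 * shift_const * err_const / ?l * (?w q * ?w r)
      + upper_const * shift_const * (of_bool (q = r) * ?w q)
      + 3 * upper_const * shift_const *
         (of_bool (fst q = fst r) * (?w q * ?w r * inverse (euler_factor (fst q)))))))"
  proof (intro sum_mono)
    fix q r assume qr: "q \<in> Q" "r \<in> Q"
    have "b q * b r * covar x q r \<le> \<bar>b q\<bar> * \<bar>b r\<bar> * \<bar>covar x q r\<bar>"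
      by (metis abs_ge_self abs_mult)
    also have "\<dots> \<le> \<bar>b q\<bar> * \<bar>b r\<bar> * (main_size x *
     (diff_const * ((?w q * ?u q) * (?w r * ?u r))
      + 4 * shift_const * err_const / ?l * (?w q * ?w r)
      + upper_const * shift_const * (of_bool (q = r) * ?w q)
      + 3 * upper_const * shift_const *
         (of_bool (fst q = fst r) * (?w q * ?w r * inverse (euler_factor (fst q))))))"
      using qr covar_upper[OF x] unfolding Q_def by (intro mult_left_mono) auto
    finally show "b q * b r * covar x q r \<le> \<dots>" .
  qed
  also have "\<dots> = main_size x * (diff_const * (\<Sum>q\<in>Q. \<Sum>r\<in>Q. (?w q * \<bar>b q\<bar> * ?u q) * (?w r * \<bar>b r\<bar> * ?u r))
      + 4 * shift_const * err_const / ?l * (\<Sum>q\<in>Q. \<Sum>r\<in>Q. (?w q * \<bar>b q\<bar>) * (?w r * \<bar>b r\<bar>))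
      + upper_const * shift_const * (\<Sum>q\<in>Q. \<Sum>r\<in>Q. of_bool (q = r) * (?w q * \<bar>b q\<bar> * \<bar>b r\<bar>))
      + 3 * upper_const * shift_const * (\<Sum>q\<in>Q. \<Sum>r\<in>Q. of_bool (fst q = fst r) *
          (?w q * ?w r * inverse (euler_factor (fst q)) * (\<bar>b q\<bar> * \<bar>b r\<bar>))))"
    unfolding sum_distrib_left sum.distrib [symmetric]
    by (intro sum.cong refl) (simp only: distrib_left mult_ac)
  also have "\<dots> \<le> main_size x * (diff_const * (?B * K2)
      + 4 * shift_const * err_const / ?l * (?B * (loglog_const * ?l))
      + upper_const * shift_const * ?B + 3 * upper_const * shift_const * ?B)"
  proof (intro mult_left_mono add_mono)
    \<comment> \<open>A kernel of rank one. Since \<open>?u q \<le> 1\<close>, its square is at most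
      \<open>?u q\<close>, and the Chebyshev hypothesis bounds the weighted sum of \<open>?u\<close>
      by \<open>K2\<close>.\<close>
    have "(\<Sum>q\<in>Q. \<Sum>r\<in>Q. (?w q * \<bar>b q\<bar> * ?u q) * (?w r * \<bar>b r\<bar> * ?u r)) = (\<Sum>q\<in>Q. ?w q * \<bar>b q\<bar> * ?u q)\<^sup>2"
      by (simp only: power2_eq_square sum_product)
    also have "\<dots> \<le> (\<Sum>q\<in>Q. ?w q * \<bar>b q\<bar>\<^sup>2) * (\<Sum>q\<in>Q. ?w q * (?u q)\<^sup>2)"
      by (intro weighted_Cauchy_Schwarz w)
    also have "\<dots> \<le> ?B * K2"
    proof -
      have "(\<Sum>q\<in>Q. ?w q * (?u q)\<^sup>2) \<le> (\<Sum>q\<in>Q. ?w q * ?u q)"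
        using w by (intro sum_mono mult_left_mono) (auto simp: power2_eq_square intro: mult_left_le)
      also have "\<dots> \<le> (\<Sum>q\<in>prime_powers_upto x. ?w q * ?u q)"
        using QP pp_ratio_bounds(1)[of _ x] prime_powers_uptoD(1)[of _ x]
        by (intro sum_mono2 finite_prime_powers_upto) (auto intro!: mult_nonneg_nonneg pp_weight_nonneg)
      also have "\<dots> \<le> K2" by (rule sum_pp_weight_ratio_upper[OF x])
      finally show ?thesis using B by (intro mult_mono) (auto intro!: sum_nonneg mult_nonneg_nonneg w)
    qed
    finally show "(\<Sum>q\<in>Q. \<Sum>r\<in>Q. (?w q * \<bar>b q\<bar> * ?u q) * (?w r * \<bar>b r\<bar> * ?u r)) \<le> ?B * K2" .
  next
    \<comment> \<open>Again rank one, but now the second factor is the total weight, of order at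
      most \<open>?l\<close>; the coefficient \<open>1 / ?l\<close> just compensates it.\<close>
    have "(\<Sum>q\<in>Q. \<Sum>r\<in>Q. (?w q * \<bar>b q\<bar>) * (?w r * \<bar>b r\<bar>)) = (\<Sum>q\<in>Q. ?w q * \<bar>b q\<bar> * 1)\<^sup>2"
      by (simp only: power2_eq_square sum_product mult_1_right)
    also have "\<dots> \<le> (\<Sum>q\<in>Q. ?w q * \<bar>b q\<bar>\<^sup>2) * (\<Sum>q\<in>Q. ?w q * 1\<^sup>2)"
      by (intro weighted_Cauchy_Schwarz w)
    also have "\<dots> \<le> ?B * (loglog_const * ?l)"
    proof -
      have "(\<Sum>q\<in>Q. ?w q) \<le> (\<Sum>q\<in>prime_powers_upto x. ?w q)"
        using QP prime_powers_uptoD(1)[of _ x]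
        by (intro sum_mono2 finite_prime_powers_upto) (auto intro!: pp_weight_nonneg)
      also have "\<dots> \<le> loglog_const * ?l" by (rule sum_pp_weight_upper[OF x])
      finally show ?thesis using B by (intro mult_mono) (auto intro!: sum_nonneg w)
    qed
    finally show "(\<Sum>q\<in>Q. \<Sum>r\<in>Q. (?w q * \<bar>b q\<bar>) * (?w r * \<bar>b r\<bar>)) \<le> ?B * (loglog_const * ?l)" .
  next
    have "(\<Sum>r\<in>Q. of_bool (q = r) * (?w q * \<bar>b q\<bar> * \<bar>b r\<bar>)) = ?w q * (b q)\<^sup>2" if "q \<in> Q" for q
    proof -
      have "(\<Sum>r\<in>Q. of_bool (q = r) * (?w q * \<bar>b q\<bar> * \<bar>b r\<bar>)) = (\<Sum>r\<in>Q. if r = q then ?w q * (b q)\<^sup>2 else 0)"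
        by (intro sum.cong refl) (auto simp: power2_eq_square mult.assoc)
      thus ?thesis using finQ that by simp
    qed
    thus "(\<Sum>q\<in>Q. \<Sum>r\<in>Q. of_bool (q = r) * (?w q * \<bar>b q\<bar> * \<bar>b r\<bar>)) \<le> ?B" by simp
  next
    \<comment> \<open>Schur's test: the kernel is symmetric and nonnegative with row sums at most
      \<open>?w q\<close>, so the inequality between
      \<open>\<bar>b q\<bar> * \<bar>b r\<bar>\<close> and the mean of the squares reduces its form
      to the diagonal sum. This \<open>c\<close> shadows the constant of the locale.\<close>
    define c where "c q r = of_bool (fst q = fst r) * (?w q * ?w r * inverse (euler_factor (fst q)))" for q r
    have c_sym: "c q r = c r q" for q r by (auto simp: c_def)
    have c_nn: "c q r \<ge> 0" if "q \<in> Q" "r \<in> Q" for q r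
      using w[OF that(1)] w[OF that(2)] inverse_euler_factor_bounds[of "fst q"]
      unfolding c_def by (intro mult_nonneg_nonneg) auto
    have row: "(\<Sum>r\<in>Q. c q r) \<le> ?w q" if q: "q \<in> Q" for q
    proof -
      let ?R = "{r \<in> Q. fst r = fst q}"
      have F: "euler_factor (fst q) \<ge> 1" by (rule euler_factor_ge_1[OF w(2)[OF q]])
      have "(\<Sum>r\<in>Q. c q r) = (\<Sum>r\<in>?R. ?w q * ?w r * inverse (euler_factor (fst q)))"
        unfolding c_def using finQ by (intro sum.mono_neutral_cong_right) auto
      also have "\<dots> = ?w q * ((\<Sum>r\<in>?R. ?w r) * inverse (euler_factor (fst q)))"
        by (simp add: sum_distrib_left sum_distrib_right mult.assoc)
      also have "\<dots> \<le> ?w q * 1"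
      proof (intro mult_left_mono w[OF q])
        have "1 + (\<Sum>r\<in>?R. ?w r) \<le> euler_factor (fst q)"
          using w finQ by (intro sum_weights_le_euler_factor w(2)[OF q]) auto
        thus "(\<Sum>r\<in>?R. ?w r) * inverse (euler_factor (fst q)) \<le> 1"
          using F by (simp add: field_simps)
      qed
      finally show ?thesis by simp
    qed
    have "(\<Sum>q\<in>Q. \<Sum>r\<in>Q. of_bool (fst q = fst r) * (?w q * ?w r * inverse (euler_factor (fst q)) * (\<bar>b q\<bar> * \<bar>b r\<bar>)))
        = (\<Sum>q\<in>Q. \<Sum>r\<in>Q. c q r * (\<bar>b q\<bar> * \<bar>b r\<bar>))"
      by (simp add: c_def mult.assoc)
    also have "\<dots> \<le> (\<Sum>q\<in>Q. \<Sum>r\<in>Q. c q r * (b q)\<^sup>2 / 2 + c q r * (b r)\<^sup>2 / 2)"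
    proof (intro sum_mono)
      fix q r assume qr: "q \<in> Q" "r \<in> Q"
      have "\<bar>b q\<bar> * \<bar>b r\<bar> \<le> ((b q)\<^sup>2 + (b r)\<^sup>2) / 2"
        using sum_squares_bound[of "\<bar>b q\<bar>" "\<bar>b r\<bar>"] by simp
      from mult_left_mono[OF this c_nn[OF qr]]
      show "c q r * (\<bar>b q\<bar> * \<bar>b r\<bar>) \<le> c q r * (b q)\<^sup>2 / 2 + c q r * (b r)\<^sup>2 / 2"
        by (simp add: field_simps)
    qed
    also have "\<dots> = (\<Sum>q\<in>Q. \<Sum>r\<in>Q. c q r * (b q)\<^sup>2 / 2) + (\<Sum>q\<in>Q. \<Sum>r\<in>Q. c q r * (b r)\<^sup>2 / 2)"
      by (simp only: sum.distrib)
    also have "(\<Sum>q\<in>Q. \<Sum>r\<in>Q. c q r * (b r)\<^sup>2 / 2) = (\<Sum>q\<in>Q. \<Sum>r\<in>Q. c q r * (b q)\<^sup>2 / 2)"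
      by (subst sum.swap) (simp only: c_sym)
    also have "(\<Sum>q\<in>Q. \<Sum>r\<in>Q. c q r * (b q)\<^sup>2 / 2) + (\<Sum>q\<in>Q. \<Sum>r\<in>Q. c q r * (b q)\<^sup>2 / 2)
        = (\<Sum>q\<in>Q. (\<Sum>r\<in>Q. c q r) * (b q)\<^sup>2)"
      by (simp add: sum_distrib_right flip: sum.distrib)
    also have "\<dots> \<le> ?B" using row by (intro sum_mono mult_right_mono) auto
    finally show "(\<Sum>q\<in>Q. \<Sum>r\<in>Q. of_bool (fst q = fst r) *
        (?w q * ?w r * inverse (euler_factor (fst q)) * (\<bar>b q\<bar> * \<bar>b r\<bar>))) \<le> ?B" .
  qed (use M l shared_const_bounds err_const_nonneg in auto)
  also have "\<dots> = small_const * main_size x * ?B"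
    using l by (simp add: small_const_def field_simps)
  finally show ?thesis .
qed

section \<open>Large prime powers\<close>

abbreviation large_pp :: "real \<Rightarrow> (nat \<times> nat) set" where
  "large_pp x \<equiv> prime_powers_upto x - prime_powers_upto (x powr cut_exp)"

lemma large_ppD:
  assumes "q \<in> large_pp x"
  shows "prime (fst q)" "x \<ge> 2" "cut_exp * ln x \<le> ln (pp_val q)"
proof -
  note D = prime_powers_uptoD[of q x]
  show q: "prime (fst q)" "x \<ge> 2" using D assms by auto
  have "x powr cut_exp < pp_val q" using assms by (auto simp: prime_powers_upto_def case_prod_unfold)
  hence "ln (x powr cut_exp) < ln (pp_val q)"
    using q prime_gt_0_nat[OF q(1)] by (subst ln_less_cancel_iff) auto
  thus "cut_exp * ln x \<le> ln (pp_val q)" using q by (simp add: ln_powr)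
qed

text \<open>The logarithm of \<open>n\<close> is the sum of \<open>ln (pp_val q)\<close> over its
  exact prime powers. It is at most \<open>ln x\<close>, and each large \<open>q\<close> takes at
  least \<open>cut_exp * ln x\<close> of it.\<close>

lemma large_pp_count:
  assumes n: "n \<in> nats_upto x"
  shows "(\<Sum>q\<in>large_pp x. of_bool (q \<in> exact_powers n)) \<le> 1 / cut_exp"
proof (cases "large_pp x = {}")
  case True
  thus ?thesis using cut_exp_bounds by (simp add: True)
next
  case False
  then obtain q0 where "q0 \<in> large_pp x" by blast
  hence x: "x \<ge> 2" using large_ppD(2) by blast
  have n': "n > 0" "real n \<le> x" using n by (auto simp: nats_upto_def)
  have "cut_exp * ln x * (\<Sum>q\<in>large_pp x. of_bool (q \<in> exact_powers n))
      = (\<Sum>q\<in>large_pp x. cut_exp * ln x * of_bool (q \<in> exact_powers n))"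
    by (rule sum_distrib_left)
  also have "\<dots> \<le> (\<Sum>q\<in>large_pp x. ln (pp_val q) * of_bool (q \<in> exact_powers n))"
    by (intro sum_mono mult_right_mono large_ppD(3)) auto
  also have "\<dots> = (\<Sum>q\<in>large_pp x \<inter> exact_powers n. ln (pp_val q))"
    by (intro sum.mono_neutral_cong_right) (auto simp: finite_prime_powers_upto)
  also have "\<dots> \<le> (\<Sum>q\<in>exact_powers n. ln (pp_val q))"
  proof (intro sum_mono2)
    fix q assume "q \<in> exact_powers n - large_pp x \<inter> exact_powers n"
    hence "q \<in> prime_powers_upto x" using exact_powers_subset[OF n] by auto
    from prime_powers_uptoD(4)[OF this] show "0 \<le> ln (pp_val q)" by simp
  qed auto
  also have "\<dots> = ln (real n)"
    using additive_sum_exact_powers[of "\<lambda>n. ln (real n)" n] n' by (simp add: ln_mult)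
  also have "\<dots> \<le> ln x" using n' by simp
  finally have "ln x * (cut_exp * (\<Sum>q\<in>large_pp x. of_bool (q \<in> exact_powers n))) \<le> ln x * 1"
    by (simp add: mult_ac)
  moreover have "ln x > 0" using x by simp
  ultimately have "cut_exp * (\<Sum>q\<in>large_pp x. of_bool (q \<in> exact_powers n)) \<le> 1"
    by (simp only: mult_le_cancel_left_pos)
  thus ?thesis using cut_exp_bounds(1) by (simp only: pos_le_divide_eq mult.commute)
qed

lemma large_pp_weight_sum: "(\<Sum>q\<in>large_pp x. pp_weight q) \<le> K2 / cut_exp"
proof (cases "large_pp x = {}")
  case True
  thus ?thesis using cut_exp_bounds K2_nonneg by (simp add: True)
next
  case False
  then obtain q0 where "q0 \<in> large_pp x" by blast
  hence x: "x \<ge> 2" using large_ppD(2) by blast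
  have "cut_exp * ln x * (\<Sum>q\<in>large_pp x. pp_weight q) = (\<Sum>q\<in>large_pp x. pp_weight q * (cut_exp * ln x))"
    by (simp only: sum_distrib_left mult.commute)
  also have "\<dots> \<le> (\<Sum>q\<in>large_pp x. pp_weight q * ln (pp_val q))"
    by (intro sum_mono mult_left_mono large_ppD(3) pp_weight_nonneg large_ppD(1)) auto
  also have "\<dots> \<le> (\<Sum>q\<in>prime_powers_upto x. pp_weight q * ln (pp_val q))"
  proof (intro sum_mono2 finite_prime_powers_upto)
    fix q assume "q \<in> prime_powers_upto x - large_pp x"
    hence "q \<in> prime_powers_upto x" by simp
    from prime_powers_uptoD[OF this] show "0 \<le> pp_weight q * ln (pp_val q)"
      by (intro mult_nonneg_nonneg pp_weight_nonneg) auto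
  qed auto
  also have "\<dots> \<le> K2 * ln x" by (rule sum_pp_weight_ln[OF x])
  finally have "ln x * (cut_exp * (\<Sum>q\<in>large_pp x. pp_weight q)) \<le> ln x * K2"
    by (simp add: mult_ac)
  moreover have "ln x > 0" using x by simp
  ultimately have "cut_exp * (\<Sum>q\<in>large_pp x. pp_weight q) \<le> K2"
    by (simp only: mult_le_cancel_left_pos)
  thus ?thesis using cut_exp_bounds(1) by (simp only: pos_le_divide_eq mult.commute)
qed

text \<open>The last factor of \<open>B_var\<close>. The minimum in the exponent makes it dominate
  both 1 and the factor \<open>(1 - pp_ratio x q) powr (\<kappa> - 1)\<close> of the frequency
  bound.\<close>

definition tail_factor :: "real \<Rightarrow> nat \<times> nat \<Rightarrow> real" where
  "tail_factor x q = (1 - pp_ratio x q) powr (min (\<kappa> - 1) 0)"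

lemma tail_factor_ge:
  assumes "q \<in> prime_powers_upto x"
  shows "1 \<le> tail_factor x q" "(1 - pp_ratio x q) powr (\<kappa> - 1) \<le> tail_factor x q"
proof -
  note b = pp_ratio_bounds[OF assms]
  show "(1 - pp_ratio x q) powr (\<kappa> - 1) \<le> tail_factor x q"
    unfolding tail_factor_def using b by (intro powr_mono') auto
  have "(1 - pp_ratio x q) powr 0 \<le> tail_factor x q"
    unfolding tail_factor_def using b by (intro powr_mono') auto
  thus "1 \<le> tail_factor x q" using b by simp
qed

text \<open>Cauchy-Schwarz is applied for each \<open>n\<close> separately, where at most
  \<open>1 / cut_exp\<close> terms survive; then the sums are exchanged. Here the full
  \<open>tail_factor\<close> enters, since for \<open>\<kappa> < 1\<close> the bound on
  \<open>exact_sum\<close> is not a bounded multiple of the weight when \<open>q\<close> is near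
  \<open>x\<close>.\<close>

lemma large_variance:
  assumes x: "x \<ge> 1"
  shows "(\<Sum>n\<in>nats_upto x. \<alpha> n * (\<Sum>q\<in>large_pp x. b q * of_bool (q \<in> exact_powers n))\<^sup>2)
    \<le> upper_const / cut_exp * main_size x * (\<Sum>q\<in>large_pp x. pp_weight q * (b q)\<^sup>2 * tail_factor x q)"
proof -
  have "(\<Sum>n\<in>nats_upto x. \<alpha> n * (\<Sum>q\<in>large_pp x. b q * of_bool (q \<in> exact_powers n))\<^sup>2)
      \<le> (\<Sum>n\<in>nats_upto x. \<alpha> n * ((\<Sum>q\<in>large_pp x. of_bool (q \<in> exact_powers n) * (b q)\<^sup>2) * (1 / cut_exp)))"
  proof (intro sum_mono mult_left_mono)
    fix n assume n: "n \<in> nats_upto x"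
    let ?I = "\<lambda>q. of_bool (q \<in> exact_powers n) :: real"
    have "(\<Sum>q\<in>large_pp x. b q * ?I q)\<^sup>2 = (\<Sum>q\<in>large_pp x. ?I q * b q * 1)\<^sup>2"
      by (simp add: mult.commute)
    also have "\<dots> \<le> (\<Sum>q\<in>large_pp x. ?I q * (b q)\<^sup>2) * (\<Sum>q\<in>large_pp x. ?I q * 1\<^sup>2)"
      by (rule weighted_Cauchy_Schwarz) auto
    also have "\<dots> \<le> (\<Sum>q\<in>large_pp x. ?I q * (b q)\<^sup>2) * (1 / cut_exp)"
      using large_pp_count[OF n] by (intro mult_left_mono sum_nonneg) auto
    finally show "(\<Sum>q\<in>large_pp x. b q * ?I q)\<^sup>2 \<le> \<dots>" .
    show "\<alpha> n \<ge> 0" using n by (intro nonneg) (auto simp: nats_upto_def)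
  qed
  also have "\<dots> = (\<Sum>n\<in>nats_upto x. \<Sum>q\<in>large_pp x. (b q)\<^sup>2 / cut_exp * (\<alpha> n * of_bool (q \<in> exact_powers n)))"
    unfolding sum_distrib_left sum_distrib_right by (intro sum.cong refl) simp
  also have "\<dots> = (\<Sum>q\<in>large_pp x. (b q)\<^sup>2 / cut_exp * exact_sum x q)"
    unfolding exact_sum_def sum_distrib_left by (rule sum.swap)
  also have "\<dots> \<le> (\<Sum>q\<in>large_pp x. (b q)\<^sup>2 / cut_exp * (upper_const * main_size x * (pp_weight q * tail_factor x q)))"
  proof (intro sum_mono mult_left_mono)
    fix q assume q: "q \<in> large_pp x"
    hence q': "q \<in> prime_powers_upto x" by simp
    have "exact_sum x q \<le> upper_const * main_size x * (pp_weight q * (1 - pp_ratio x q) powr (\<kappa> - 1))"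
      using sum_exact_power_upper[OF q'] by (simp add: exact_sum_def upper_const_def pp_ratio_def)
    also have "\<dots> \<le> upper_const * main_size x * (pp_weight q * tail_factor x q)"
      using tail_factor_ge(2)[OF q'] shared_const_bounds main_size_pos[OF x] pp_weight_nonneg[OF large_ppD(1)[OF q]]
      by (intro mult_left_mono) auto
    finally show "exact_sum x q \<le> upper_const * main_size x * (pp_weight q * tail_factor x q)" .
  qed (use cut_exp_bounds in auto)
  also have "\<dots> = upper_const / cut_exp * main_size x * (\<Sum>q\<in>large_pp x. pp_weight q * (b q)\<^sup>2 * tail_factor x q)"
    unfolding sum_distrib_left by (intro sum.cong refl) (simp add: field_simps)
  finally show ?thesis .
qed

text \<open>Large prime powers are not treated as centred variables: their share of the mean is
  bounded on its own, by Cauchy-Schwarz against the bounded sum of their weights.\<close>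

lemma large_mean:
  "(\<Sum>q\<in>large_pp x. b q * pp_mean q)\<^sup>2 \<le> K2 / cut_exp * (\<Sum>q\<in>large_pp x. pp_weight q * (b q)\<^sup>2)"
proof -
  have v: "0 \<le> pp_mean q" "pp_mean q \<le> pp_weight q" if "q \<in> large_pp x" for q
    using pp_mean_bounds[OF large_ppD(1)[OF that]] by auto
  have w: "0 \<le> pp_weight q" if "q \<in> large_pp x" for q
    using v[OF that] by linarith
  have "(\<Sum>q\<in>large_pp x. b q * pp_mean q)\<^sup>2 = (\<Sum>q\<in>large_pp x. pp_mean q * b q * 1)\<^sup>2"
    by (simp add: mult.commute)
  also have "\<dots> \<le> (\<Sum>q\<in>large_pp x. pp_mean q * (b q)\<^sup>2) * (\<Sum>q\<in>large_pp x. pp_mean q * 1\<^sup>2)"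
    by (rule weighted_Cauchy_Schwarz) (use v in auto)
  also have "\<dots> \<le> (\<Sum>q\<in>large_pp x. pp_weight q * (b q)\<^sup>2) * (\<Sum>q\<in>large_pp x. pp_weight q * 1\<^sup>2)"
    using v w by (intro mult_mono sum_mono sum_nonneg mult_right_mono mult_nonneg_nonneg) auto
  also have "\<dots> \<le> (\<Sum>q\<in>large_pp x. pp_weight q * (b q)\<^sup>2) * (K2 / cut_exp)"
    using large_pp_weight_sum w by (intro mult_left_mono sum_nonneg mult_nonneg_nonneg) auto
  finally show ?thesis by (simp only: mult.commute)
qed

section \<open>Total variance and the theorem\<close>

text \<open>The 3 comes from squaring a sum of three parts: the small prime powers, the large ones,
  and the mean of the large ones. The last part is the same for every \<open>n\<close>, so it is
  multiplied by \<open>S_sum \<alpha> x\<close>, hence its \<open>upper_const\<close>.\<close>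

definition total_const :: real where
  "total_const = 3 * (small_const + upper_const / cut_exp + upper_const * (K2 / cut_exp))"

lemma total_variance:
  assumes x: "x \<ge> 1"
  shows "(\<Sum>n\<in>nats_upto x. \<alpha> n * (\<Sum>q\<in>prime_powers_upto x. b q * (of_bool (q \<in> exact_powers n) - pp_mean q))\<^sup>2)
    \<le> total_const * main_size x * (\<Sum>q\<in>prime_powers_upto x. pp_weight q * (b q)\<^sup>2 * tail_factor x q)"
proof -
  let ?P = "prime_powers_upto x" and ?Q = "prime_powers_upto (x powr cut_exp)"
  let ?B = "\<Sum>q\<in>?P. pp_weight q * (b q)\<^sup>2 * tail_factor x q"
  let ?I = "\<lambda>n q. of_bool (q \<in> exact_powers n) :: real"
  have QP: "?Q \<subseteq> ?P" using small_pp(1)[OF x] by blast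
  have fin: "finite ?P" by (rule finite_prime_powers_upto)
  have M: "main_size x > 0" by (rule main_size_pos[OF x])
  have small_nn: "small_const \<ge> 0"
    using shared_const_bounds K2_nonneg err_const_nonneg loglog_const_nonneg
    unfolding small_const_def by (intro add_nonneg_nonneg mult_nonneg_nonneg) auto
  have w: "0 \<le> pp_weight q" if "q \<in> ?P" for q
    using prime_powers_uptoD(1)[OF that] by (rule pp_weight_nonneg)
  have le1: "(\<Sum>q\<in>A. pp_weight q * (b q)\<^sup>2) \<le> ?B"
    and le2: "(\<Sum>q\<in>A. pp_weight q * (b q)\<^sup>2 * tail_factor x q) \<le> ?B" if "A \<subseteq> ?P" for A
  proof -
    have "(\<Sum>q\<in>A. pp_weight q * (b q)\<^sup>2 * 1) \<le> (\<Sum>q\<in>A. pp_weight q * (b q)\<^sup>2 * tail_factor x q)"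
      using that w tail_factor_ge(1) by (intro sum_mono mult_left_mono) auto
    moreover show "(\<Sum>q\<in>A. pp_weight q * (b q)\<^sup>2 * tail_factor x q) \<le> ?B"
      using w that by (intro sum_mono2 fin) (auto simp: tail_factor_def)
    ultimately show "(\<Sum>q\<in>A. pp_weight q * (b q)\<^sup>2) \<le> ?B" by simp
  qed
  define s where "s n = (\<Sum>q\<in>?Q. b q * (?I n q - pp_mean q))" for n
  define t where "t n = (\<Sum>q\<in>large_pp x. b q * ?I n q)" for n
  define m where "m = (\<Sum>q\<in>large_pp x. b q * pp_mean q)"
  have "(\<Sum>n\<in>nats_upto x. \<alpha> n * (\<Sum>q\<in>?P. b q * (?I n q - pp_mean q))\<^sup>2)
      \<le> (\<Sum>n\<in>nats_upto x. \<alpha> n * (3 * (s n)\<^sup>2 + 3 * (t n)\<^sup>2 + 3 * m\<^sup>2))"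
  proof (intro sum_mono mult_left_mono)
    fix n assume n: "n \<in> nats_upto x"
    have "(\<Sum>q\<in>?P. b q * (?I n q - pp_mean q)) = (\<Sum>q\<in>large_pp x. b q * (?I n q - pp_mean q)) + s n"
      unfolding s_def by (rule sum.subset_diff[OF QP fin])
    also have "(\<Sum>q\<in>large_pp x. b q * (?I n q - pp_mean q)) = t n - m"
      by (simp add: t_def m_def right_diff_distrib sum_subtractf)
    finally have eq: "(\<Sum>q\<in>?P. b q * (?I n q - pp_mean q)) = t n - m + s n" .
    have "3 * (s n)\<^sup>2 + 3 * (t n)\<^sup>2 + 3 * m\<^sup>2 - (t n - m + s n)\<^sup>2
        = (s n - t n)\<^sup>2 + (s n + m)\<^sup>2 + (t n + m)\<^sup>2"
      by (simp add: power2_eq_square algebra_simps)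
    also have "\<dots> \<ge> 0" by simp
    finally show "(\<Sum>q\<in>?P. b q * (?I n q - pp_mean q))\<^sup>2 \<le> 3 * (s n)\<^sup>2 + 3 * (t n)\<^sup>2 + 3 * m\<^sup>2"
      unfolding eq by simp
    show "\<alpha> n \<ge> 0" using n by (intro nonneg) (auto simp: nats_upto_def)
  qed
  also have "\<dots> = 3 * (\<Sum>n\<in>nats_upto x. \<alpha> n * (s n)\<^sup>2) + 3 * (\<Sum>n\<in>nats_upto x. \<alpha> n * (t n)\<^sup>2) + 3 * (S_sum \<alpha> x * m\<^sup>2)"
    unfolding S_sum_def sum_distrib_left sum_distrib_right sum.distrib[symmetric]
    by (intro sum.cong refl) (simp add: algebra_simps)
  also have "\<dots> \<le> 3 * (small_const * main_size x * ?B) + 3 * (upper_const / cut_exp * main_size x * ?B)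
      + 3 * ((upper_const * main_size x) * (K2 / cut_exp * ?B))"
  proof (intro add_mono mult_left_mono)
    have "(\<Sum>n\<in>nats_upto x. \<alpha> n * (s n)\<^sup>2) \<le> small_const * main_size x * (\<Sum>q\<in>?Q. pp_weight q * (b q)\<^sup>2)"
      unfolding s_def by (rule small_variance[OF x])
    also have "\<dots> \<le> small_const * main_size x * ?B"
      using le1[OF QP] small_nn M by (intro mult_left_mono) auto
    finally show "(\<Sum>n\<in>nats_upto x. \<alpha> n * (s n)\<^sup>2) \<le> small_const * main_size x * ?B" .
    have "(\<Sum>n\<in>nats_upto x. \<alpha> n * (t n)\<^sup>2)
        \<le> upper_const / cut_exp * main_size x * (\<Sum>q\<in>large_pp x. pp_weight q * (b q)\<^sup>2 * tail_factor x q)"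
      unfolding t_def by (rule large_variance[OF x])
    also have "\<dots> \<le> upper_const / cut_exp * main_size x * ?B"
      using le2[of "large_pp x"] shared_const_bounds cut_exp_bounds M by (intro mult_left_mono) auto
    finally show "(\<Sum>n\<in>nats_upto x. \<alpha> n * (t n)\<^sup>2) \<le> upper_const / cut_exp * main_size x * ?B" .
    show "S_sum \<alpha> x * m\<^sup>2 \<le> (upper_const * main_size x) * (K2 / cut_exp * ?B)"
    proof (rule mult_mono)
      show "S_sum \<alpha> x \<le> upper_const * main_size x"
        using S_sum_upper[OF x] by (simp add: upper_const_def)
      have "m\<^sup>2 \<le> K2 / cut_exp * (\<Sum>q\<in>large_pp x. pp_weight q * (b q)\<^sup>2)"
        unfolding m_def by (rule large_mean)
      also have "\<dots> \<le> K2 / cut_exp * ?B"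
        using le1[of "large_pp x"] K2_nonneg cut_exp_bounds by (intro mult_left_mono) auto
      finally show "m\<^sup>2 \<le> K2 / cut_exp * ?B" .
    qed (use shared_const_bounds M in auto)
  qed auto
  also have "\<dots> = total_const * main_size x * ?B"
    by (simp add: total_const_def algebra_simps)
  finally show ?thesis .
qed

text \<open>The centred indicators are real, so the squared modulus splits into the real quadratic
  forms with coefficients \<open>Re (g q)\<close> and \<open>Im (g q)\<close>; \<open>B_var\<close>
  splits in the same way.\<close>

lemma weighted_variance:
  assumes x: "x \<ge> 1" and f: "additive_function f"
  shows "(\<Sum>n\<in>nats_upto x. \<alpha> n * (cmod (f n - A_mean \<alpha> f \<sigma> x))\<^sup>2)
    \<le> total_const * main_size x * B_var \<alpha> f \<sigma> \<kappa> x"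
proof -
  let ?P = "prime_powers_upto x"
  let ?I = "\<lambda>n q. of_bool (q \<in> exact_powers n) :: real"
  define g where "g q = f (fst q ^ snd q)" for q
  have "f 1 = f 1 + f 1"
    using f unfolding additive_function_def by (metis coprime_1_left mult.right_neutral zero_less_one)
  hence f1: "f 1 = 0" by simp
  have A: "A_mean \<alpha> f \<sigma> x = (\<Sum>q\<in>?P. g q * of_real (pp_mean q))"
    unfolding A_mean_def g_def pp_mean_def pp_weight_def
    by (intro sum.cong refl) (auto simp: divide_inverse)
  have fn: "f n = (\<Sum>q\<in>?P. g q * of_real (?I n q))" if n: "n \<in> nats_upto x" for n
  proof -
    have "f n = (\<Sum>q\<in>exact_powers n. g q)" unfolding g_def
      using f f1 n by (intro additive_sum_exact_powers) (auto simp: additive_function_def nats_upto_def)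
    also have "\<dots> = (\<Sum>q\<in>?P. g q * of_real (?I n q))"
      using exact_powers_subset[OF n]
      by (intro sum.mono_neutral_cong_left finite_prime_powers_upto) auto
    finally show ?thesis .
  qed
  have diff: "(cmod (f n - A_mean \<alpha> f \<sigma> x))\<^sup>2 =
      (\<Sum>q\<in>?P. Re (g q) * (?I n q - pp_mean q))\<^sup>2 + (\<Sum>q\<in>?P. Im (g q) * (?I n q - pp_mean q))\<^sup>2"
    if n: "n \<in> nats_upto x" for n
  proof -
    have "f n - A_mean \<alpha> f \<sigma> x = (\<Sum>q\<in>?P. g q * of_real (?I n q - pp_mean q))"
      by (simp only: fn[OF n] A of_real_diff right_diff_distrib sum_subtractf)
    thus ?thesis by (simp only: cmod_power2 Re_sum Im_sum Re_complex_of_real Im_complex_of_real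
        times_complex.sel mult_zero_right diff_zero add_0)
  qed
  have B: "B_var \<alpha> f \<sigma> \<kappa> x = (\<Sum>q\<in>?P. pp_weight q * (Re (g q))\<^sup>2 * tail_factor x q)
      + (\<Sum>q\<in>?P. pp_weight q * (Im (g q))\<^sup>2 * tail_factor x q)"
    unfolding B_var_def sum.distrib[symmetric] tail_factor_def pp_ratio_def pp_weight_def g_def
    by (intro sum.cong refl) (auto simp: cmod_power2 add_divide_distrib algebra_simps)
  have "(\<Sum>n\<in>nats_upto x. \<alpha> n * (cmod (f n - A_mean \<alpha> f \<sigma> x))\<^sup>2)
      = (\<Sum>n\<in>nats_upto x. \<alpha> n * (\<Sum>q\<in>?P. Re (g q) * (?I n q - pp_mean q))\<^sup>2)
      + (\<Sum>n\<in>nats_upto x. \<alpha> n * (\<Sum>q\<in>?P. Im (g q) * (?I n q - pp_mean q))\<^sup>2)"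
    unfolding sum.distrib[symmetric] by (intro sum.cong refl) (simp only: diff distrib_left)
  also have "\<dots> \<le> total_const * main_size x * (\<Sum>q\<in>?P. pp_weight q * (Re (g q))\<^sup>2 * tail_factor x q)
      + total_const * main_size x * (\<Sum>q\<in>?P. pp_weight q * (Im (g q))\<^sup>2 * tail_factor x q)"
    by (intro add_mono total_variance[OF x])
  finally show ?thesis unfolding B by (simp only: distrib_left)
qed

end

theorem theorem3:
  fixes \<delta> \<kappa> K1 K2 :: real
  assumes "\<delta> > 0"
  shows "\<exists>C>0. \<forall>(f :: nat \<Rightarrow> complex) (\<alpha> :: nat \<Rightarrow> real) (c :: real) (\<sigma> :: real).
    additive_function f \<longrightarrow>
    multiplicative_function \<alpha> \<longrightarrow>
    (\<forall>n\<ge>1. \<alpha> n \<ge> 0) \<longrightarrow>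
    c > 0 \<longrightarrow> \<sigma> \<ge> 0 \<longrightarrow>
    (\<forall>p. prime p \<longrightarrow> summable (\<lambda>k. \<alpha> (p ^ k) * real p powr (- (real k * \<sigma>)))) \<longrightarrow>
    (\<forall>x\<ge>1. \<forall>a::nat. a \<ge> 1 \<and> real a \<le> x powr \<delta> \<and> squarefree a \<and> card (prime_factors a) \<le> 2 \<longrightarrow>
       (\<exists>E. \<bar>E\<bar> \<le> K1 * (1 / ln (ln (3 * x))) \<and>
         (\<Sum>n\<in>{n \<in> nats_upto x. coprime n a}. \<alpha> n) =
           c * x powr \<sigma> * ln (3 * x) powr (\<kappa> - 1) * (inverse (F_prod \<alpha> \<sigma> a) + E))) \<longrightarrow>
    (\<forall>x\<ge>2. (\<Sum>(p, k)\<in>prime_powers_upto x.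
         \<alpha> (p ^ k) / real p powr (real k * \<sigma>) * ln (real (p ^ k))) \<le> K2 * ln x) \<longrightarrow>
    (\<forall>x\<ge>1. inverse (S_sum \<alpha> x) *
         (\<Sum>n\<in>nats_upto x. \<alpha> n * (cmod (f n - A_mean \<alpha> f \<sigma> x))\<^sup>2)
       \<le> C * B_var \<alpha> f \<sigma> \<kappa> x)"
proof -
  obtain C1 where C1: "C1 > 0"
    "\<And>\<alpha> c \<sigma> x. weighted_asymptotics \<alpha> c \<sigma> \<kappa> \<delta> K1 K2 \<Longrightarrow> x \<ge> 1 \<Longrightarrow>
       weighted_asymptotics.main_size c \<sigma> \<kappa> x \<le> C1 * S_sum \<alpha> x"
    using main_size_le_S_sum[of \<kappa> \<delta> K1 K2] by blast
  \<comment> \<open>Outside the locale the sign of \<open>total_const\<close> is not known, hence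
    the absolute value. As \<open>T\<close> may be 0, the \<open>+ 1\<close> in \<open>C\<close>
    ensures positivity.\<close>
  define T where "T = \<bar>weighted_asymptotics.total_const \<kappa> \<delta> K1 K2\<bar>"
  define C where "C = T * C1 + 1"
  have T: "T \<ge> 0" by (simp add: T_def)
  have C_pos: "C > 0" using T C1(1) by (simp add: C_def add_nonneg_pos)
  have bound: "inverse (S_sum \<alpha> x) * (\<Sum>n\<in>nats_upto x. \<alpha> n * (cmod (f n - A_mean \<alpha> f \<sigma> x))\<^sup>2)
       \<le> C * B_var \<alpha> f \<sigma> \<kappa> x"
    if f: "additive_function f" and W: "weighted_asymptotics \<alpha> c \<sigma> \<kappa> \<delta> K1 K2" and x: "x \<ge> 1"
    for f \<alpha> c \<sigma> x
  proof -
    interpret weighted_asymptotics \<alpha> c \<sigma> \<kappa> \<delta> K1 K2 by (fact W)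
    have S: "S_sum \<alpha> x > 0" using S_sum_ge_1[OF x] by linarith
    have B: "B_var \<alpha> f \<sigma> \<kappa> x \<ge> 0"
      unfolding B_var_def by (intro sum_nonneg)
        (auto simp: prime_powers_upto_def Suc_le_eq prime_gt_0_nat intro!: mult_nonneg_nonneg divide_nonneg_nonneg nonneg)
    have "(\<Sum>n\<in>nats_upto x. \<alpha> n * (cmod (f n - A_mean \<alpha> f \<sigma> x))\<^sup>2)
        \<le> total_const * main_size x * B_var \<alpha> f \<sigma> \<kappa> x"
      by (rule weighted_variance[OF x f])
    also have "\<dots> \<le> T * (C1 * S_sum \<alpha> x) * B_var \<alpha> f \<sigma> \<kappa> x"
      using C1(2)[OF W x] main_size_pos[OF x] B unfolding T_def
      by (intro mult_right_mono mult_mono) auto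
    also have "\<dots> \<le> S_sum \<alpha> x * (C * B_var \<alpha> f \<sigma> \<kappa> x)"
      using S B by (simp add: C_def algebra_simps)
    finally show ?thesis using S by (simp add: inverse_eq_divide pos_divide_le_eq mult.commute)
  qed
  show ?thesis
  proof (intro exI[of _ C] conjI C_pos allI impI, goal_cases)
    case (1 f \<alpha> c \<sigma> x)
    have "weighted_asymptotics \<alpha> c \<sigma> \<kappa> \<delta> K1 K2"
      using 1 assms by unfold_locales auto
    with 1 show ?case by (intro bound) auto
  qed
qed

end
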